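(* Let $\mathcal{M}$ be a finite factor with a faithful normal trace $\tau$. Assume $T\in\mathcal{M}$ is an invertible operator with polar decomposition $T=U|T|$ and $f$ is a polynomial. Then for every $0\leq\lambda\leq 1$, $f(|T|^{\lambda}U|T|^{1-\lambda})$ is in the weak operator closure of the set $$\Big\{\sum_{i=1}^{n}z_{i}U_{i}f(T)U_{i}^{*}\ \Big|\ n\in\mathbb{N},\ U_{1},\dots,U_{n}\in\mathscr{U}(\mathcal{M}),\ z_1,\dots,z_n\in\mathbb{C},\ \sum_{i=1}^{n}|z_{i}|\leq 1\Big\}.$$
   Context: A von Neumann algebra $\mathcal{M}$ on a Hilbert space is a factor if $\mathcal{M}\cap\mathcal{M}'=\mathbb{C}I$, and is finite if it has a faithful normal tracial state; $\tau$ denotes this faithful normal tracial state. All factors are assumed to have separable predual. $\mathscr{U}(\mathcal{M})$ is the set of unitary operators in $\mathcal{M}$. The operator $\bigtriangleup_{\lambda}(T)=|T|^{\lambda}U|T|^{1-\lambda}$ is called the $\lambda$-Aluthge transform of $T$. Polynomials have complex coefficients. *)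

theory Defs
  imports "HOL-Analysis.Analysis" "HOL-Computational_Algebra.Polynomial"
begin

section \<open>Complex Hilbert spaces\<close>

text \<open>
  A complex Hilbert space. The superclass \<^class>\<open>real_inner\<close> carries the underlying real Hilbert
  space, whose inner product is the real part of the complex one, so that norm, topology and
  completeness are those of the library. The complex inner product is linear in its first argument.
\<close>

class complex_hilbert_space = real_inner + banach +
  fixes scaleC :: "complex \<Rightarrow> 'a \<Rightarrow> 'a" (infixr "*\<^sub>C" 75)
    and cinner :: "'a \<Rightarrow> 'a \<Rightarrow> complex"
  assumes scaleC_add_right: "c *\<^sub>C (x + y) = c *\<^sub>C x + c *\<^sub>C y"
    and scaleC_add_left: "(c + d) *\<^sub>C x = c *\<^sub>C x + d *\<^sub>C x"
    and scaleC_scaleC: "c *\<^sub>C (d *\<^sub>C x) = (c * d) *\<^sub>C x"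
    and scaleC_of_real: "complex_of_real r *\<^sub>C x = r *\<^sub>R x"
    and cinner_add_left: "cinner (x + y) z = cinner x z + cinner y z"
    and cinner_scaleC_left: "cinner (c *\<^sub>C x) y = c * cinner x y"
    and cinner_commute: "cinner x y = cnj (cinner y x)"
    and Re_cinner: "Re (cinner x y) = x \<bullet> y"

section \<open>Bounded operators\<close>

text \<open>
  Operators are plain functions; the product of operators is \<^term>\<open>(\<circ>)\<close> and the operator norm
  is \<^const>\<open>onorm\<close>.
\<close>

definition bounded_clinear :: "('h::complex_hilbert_space \<Rightarrow> 'h) \<Rightarrow> bool" where
  "bounded_clinear A \<longleftrightarrow> bounded_linear A \<and> (\<forall>c x. A (c *\<^sub>C x) = c *\<^sub>C A x)"

definition bounded_ops :: "('h::complex_hilbert_space \<Rightarrow> 'h) set" where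
  "bounded_ops = Collect bounded_clinear"

definition adj :: "('h::complex_hilbert_space \<Rightarrow> 'h) \<Rightarrow> ('h \<Rightarrow> 'h)" where
  "adj A = (THE B. \<forall>x y. cinner (A x) y = cinner x (B y))"

definition invertible_op :: "('h::complex_hilbert_space \<Rightarrow> 'h) \<Rightarrow> bool" where
  "invertible_op A \<longleftrightarrow> bounded_clinear A \<and> (\<exists>B. bounded_clinear B \<and> A \<circ> B = id \<and> B \<circ> A = id)"

definition spectrum :: "('h::complex_hilbert_space \<Rightarrow> 'h) \<Rightarrow> complex set" where
  "spectrum A = {z. \<not> invertible_op (\<lambda>x. A x - z *\<^sub>C x)}"

definition op_poly :: "complex poly \<Rightarrow> ('h::complex_hilbert_space \<Rightarrow> 'h) \<Rightarrow> ('h \<Rightarrow> 'h)" where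
  "op_poly p A = (\<lambda>x. \<Sum>i\<le>degree p. coeff p i *\<^sub>C (A ^^ i) x)"

text \<open>
  The continuous functional calculus of a self-adjoint operator \<open>A\<close>: for \<open>g\<close> continuous on the
  spectrum, \<open>g(A)\<close> is the norm limit of \<open>p\<^sub>n(A)\<close> for any polynomials \<open>p\<^sub>n\<close> converging to \<open>g\<close>
  uniformly on the (real, compact) spectrum of \<open>A\<close>. Such sequences exist by the Weierstrass
  approximation theorem, which is what makes the operator unique.
\<close>

definition cont_fun_calc ::
  "(complex \<Rightarrow> complex) \<Rightarrow> ('h::complex_hilbert_space \<Rightarrow> 'h) \<Rightarrow> ('h \<Rightarrow> 'h)" where
  "cont_fun_calc g A = (THE B. bounded_clinear B \<and>
     (\<forall>p. uniform_limit (spectrum A) (\<lambda>n z. poly (p n) z) g sequentially \<longrightarrow>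
          (\<lambda>n. onorm (\<lambda>x. op_poly (p n) A x - B x)) \<longlonglongrightarrow> 0))"

text \<open>
  Real powers of a positive operator. Exponent \<open>0\<close> is only meant for invertible operators, where it
  gives the identity: \<^term>\<open>0 powr 0 = (0::real)\<close> makes the function discontinuous at \<open>0\<close>.
\<close>

definition op_powr :: "('h::complex_hilbert_space \<Rightarrow> 'h) \<Rightarrow> real \<Rightarrow> ('h \<Rightarrow> 'h)" where
  "op_powr A s = cont_fun_calc (\<lambda>z. complex_of_real (Re z powr s)) A"

definition op_abs :: "('h::complex_hilbert_space \<Rightarrow> 'h) \<Rightarrow> ('h \<Rightarrow> 'h)" where
  "op_abs A = op_powr (adj A \<circ> A) (1/2)"

definition partial_isometry :: "('h::complex_hilbert_space \<Rightarrow> 'h) \<Rightarrow> bool" where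
  "partial_isometry U \<longleftrightarrow> bounded_clinear U \<and>
     (\<forall>x. (\<forall>y. U y = 0 \<longrightarrow> cinner x y = 0) \<longrightarrow> norm (U x) = norm x)"

text \<open>\<open>T = U|T|\<close> is the polar decomposition of \<open>T\<close>.\<close>

definition polar_decomposition ::
  "('h::complex_hilbert_space \<Rightarrow> 'h) \<Rightarrow> ('h \<Rightarrow> 'h) \<Rightarrow> bool" where
  "polar_decomposition T U \<longleftrightarrow>
     partial_isometry U \<and> {x. U x = 0} = {x. T x = 0} \<and> T = U \<circ> op_abs T"

section \<open>Operator topologies\<close>

text \<open>
  Both topologies on the bounded operators are initial topologies: the weak operator topology for
  the functionals \<open>A \<mapsto> \<langle>A x, y\<rangle>\<close>, the ultraweak topology for the functionals
  \<open>A \<mapsto> \<Sum>n. \<langle>A x\<^sub>n, y\<^sub>n\<rangle>\<close> with \<open>\<Sum>n. \<parallel>x\<^sub>n\<parallel>\<^sup>2 < \<infinity>\<close> and \<open>\<Sum>n. \<parallel>y\<^sub>n\<parallel>\<^sup>2 < \<infinity>\<close>. They are pulled back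
  from product topologies on spaces of complex-valued functions.
\<close>

definition weak_op_topology :: "('h::complex_hilbert_space \<Rightarrow> 'h) topology" where
  "weak_op_topology = pullback_topology bounded_ops
     (\<lambda>A. \<lambda>(x, y)\<in>UNIV. cinner (A x) y)
     (product_topology (\<lambda>_. euclidean) (UNIV :: ('h \<times> 'h) set))"

definition ell2_seqs :: "(nat \<Rightarrow> 'h::complex_hilbert_space) set" where
  "ell2_seqs = {x. summable (\<lambda>n. (norm (x n))\<^sup>2)}"

definition ultraweak_topology :: "('h::complex_hilbert_space \<Rightarrow> 'h) topology" where
  "ultraweak_topology = pullback_topology bounded_ops
     (\<lambda>A. \<lambda>(x, y)\<in>ell2_seqs \<times> ell2_seqs. \<Sum>n. cinner (A (x n)) (y n))
     (product_topology (\<lambda>_. euclidean) (ell2_seqs \<times> ell2_seqs))"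

section \<open>Von Neumann algebras\<close>

definition von_neumann_algebra :: "('h::complex_hilbert_space \<Rightarrow> 'h) set \<Rightarrow> bool" where
  "von_neumann_algebra M \<longleftrightarrow>
     M \<subseteq> bounded_ops \<and> id \<in> M \<and>
     (\<forall>A\<in>M. \<forall>B\<in>M. (\<lambda>x. A x + B x) \<in> M \<and> A \<circ> B \<in> M) \<and>
     (\<forall>A\<in>M. \<forall>c. (\<lambda>x. c *\<^sub>C A x) \<in> M) \<and>
     (\<forall>A\<in>M. adj A \<in> M) \<and>
     closedin weak_op_topology M"

definition commutant :: "('h::complex_hilbert_space \<Rightarrow> 'h) set \<Rightarrow> ('h \<Rightarrow> 'h) set" where
  "commutant M = {B \<in> bounded_ops. \<forall>A\<in>M. A \<circ> B = B \<circ> A}"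

definition factor :: "('h::complex_hilbert_space \<Rightarrow> 'h) set \<Rightarrow> bool" where
  "factor M \<longleftrightarrow> von_neumann_algebra M \<and> M \<inter> commutant M = {\<lambda>x. c *\<^sub>C x | c. True}"

definition unitaries :: "('h::complex_hilbert_space \<Rightarrow> 'h) set \<Rightarrow> ('h \<Rightarrow> 'h) set" where
  "unitaries M = {U \<in> M. adj U \<circ> U = id \<and> U \<circ> adj U = id}"

text \<open>
  Functionals on \<open>M\<close> are functions on all operators of which only the values on \<open>M\<close> matter.
  The predual of \<open>M\<close> is the space of normal, i.e. ultraweakly continuous, linear functionals on \<open>M\<close>
  with the norm of the dual of \<open>M\<close>.
\<close>

definition linear_functional_on ::
  "('h::complex_hilbert_space \<Rightarrow> 'h) set \<Rightarrow> (('h \<Rightarrow> 'h) \<Rightarrow> complex) \<Rightarrow> bool" where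
  "linear_functional_on M \<phi> \<longleftrightarrow>
     (\<forall>A\<in>M. \<forall>B\<in>M. \<phi> (\<lambda>x. A x + B x) = \<phi> A + \<phi> B) \<and>
     (\<forall>A\<in>M. \<forall>c. \<phi> (\<lambda>x. c *\<^sub>C A x) = c * \<phi> A)"

definition predual ::
  "('h::complex_hilbert_space \<Rightarrow> 'h) set \<Rightarrow> (('h \<Rightarrow> 'h) \<Rightarrow> complex) set" where
  "predual M = {\<phi>. linear_functional_on M \<phi> \<and>
                   continuous_map (subtopology ultraweak_topology M) euclidean \<phi>}"

definition separable_predual :: "('h::complex_hilbert_space \<Rightarrow> 'h) set \<Rightarrow> bool" where
  "separable_predual M \<longleftrightarrow>
     (\<exists>D. countable D \<and> D \<subseteq> predual M \<and>
       (\<forall>\<phi>\<in>predual M. \<forall>e>0. \<exists>\<psi>\<in>D. \<forall>A\<in>M. onorm A \<le> 1 \<longrightarrow> cmod (\<phi> A - \<psi> A) \<le> e))"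

definition faithful_normal_tracial_state ::
  "('h::complex_hilbert_space \<Rightarrow> 'h) set \<Rightarrow> (('h \<Rightarrow> 'h) \<Rightarrow> complex) \<Rightarrow> bool" where
  "faithful_normal_tracial_state M \<tau> \<longleftrightarrow>
     \<tau> \<in> predual M \<and>
     (\<forall>A\<in>M. \<tau> (adj A \<circ> A) \<in> \<real>\<^sub>\<ge>\<^sub>0) \<and>
     \<tau> id = 1 \<and>
     (\<forall>A\<in>M. \<forall>B\<in>M. \<tau> (A \<circ> B) = \<tau> (B \<circ> A)) \<and>
     (\<forall>A\<in>M. \<tau> (adj A \<circ> A) = 0 \<longrightarrow> A = (\<lambda>x. 0))"

definition finite_factor :: "('h::complex_hilbert_space \<Rightarrow> 'h) set \<Rightarrow> bool" where
  "finite_factor M \<longleftrightarrow> factor M \<and> (\<exists>\<tau>. faithful_normal_tracial_state M \<tau>)"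

end

theory Submission
  imports Defs "HOL-Computational_Algebra.Fundamental_Theorem_Algebra"
begin

text \<open>
  Write \<open>H = |T|\<close>. Since \<open>T\<close> is invertible, \<open>U = T H\<^sup>-\<^sup>1\<close> is a unitary of the algebra, and the Aluthge transform
  \<open>H\<^sup>l U H\<^sup>1\<^sup>-\<^sup>l = H\<^sup>l T H\<^sup>-\<^sup>l\<close> is similar to \<open>T\<close>. So the operator in question is \<open>F l\<close> for the entire function
  \<open>F z = H\<^sup>z f(T) H\<^sup>-\<^sup>z\<close>. On the boundary of the strip \<open>0 \<le> Re z \<le> 1\<close> this function takes values in the unitary orbit
  of \<open>f(T)\<close>: the imaginary powers of \<open>H\<close> are unitary, and \<open>F 1 = H f(T) H\<^sup>-\<^sup>1 = U* f(T) U\<close> because \<open>H = U* T\<close>. An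
  interpolation argument in the spirit of the three lines theorem then puts \<open>F l\<close> into the closed convex hull
  \<open>C\<close> of the orbit, even in the norm topology.

  The interpolation is elementary. Let \<open>d x\<close> be the norm distance from \<open>F x\<close> to \<open>C\<close>. The value \<open>F x\<close> is up to
  \<open>O(r\<^sup>3)\<close> the average of \<open>F\<close> over the four points \<open>x + r, x - r, x + \<i> r, x - \<i> r\<close>
  (\<open>conjugate_cpow_four_point\<close>), and the distance to \<open>C\<close> at the last two points is at most \<open>d x\<close> because
  \<open>F (x + \<i> r)\<close> is a conjugate of \<open>F x\<close> by a unitary that preserves \<open>C\<close>. As the distance to a convex set
  is a convex function, the second differences of \<open>d\<close> are nonnegative up to \<open>O(r\<^sup>3)\<close>; so \<open>d\<close> is convex, and
  being zero at \<open>0\<close> and \<open>1\<close> it is zero in between (\<open>conjugate_cpow_in_closed_convex_hull\<close>).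

  Complex powers of \<open>H\<close> need the continuous functional calculus. It rests on the estimate of \<open>\<parallel>p(A)\<parallel>\<close> by the values
  of \<open>p\<close> on the spectrum of a self-adjoint \<open>A\<close> (\<open>norm_bpoly_le\<close>), which follows from the C*-identity,
  the factorization of polynomials, and the fact that the norm of a self-adjoint operator is up to sign in
  its spectrum. The adjoint comes from Riesz' representation theorem, and invertibility of operators from the
  Lax-Milgram lemma.
\<close>

section \<open>Complex scalars and inner products\<close>

lemma cinner_scaleC_right: "cinner x (c *\<^sub>C y) = cnj c * cinner x y"
  by (metis cinner_commute cinner_scaleC_left complex_cnj_mult)

lemma cinner_self: "cinner x x = complex_of_real (x \<bullet> x)"
proof -
  have "Im (cinner x x) = - Im (cinner x x)"
    by (metis cinner_commute complex_cnj complex.sel(2) complex_surj)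
  then show ?thesis
    by (simp add: complex_eq_iff Re_cinner)
qed

lemma cinner_diff_left: "cinner (x - y) z = cinner x z - cinner y z"
  using cinner_add_left[of "x - y" y z] by simp

lemma cinner_add_right: "cinner x (y + z) = cinner x y + cinner x z"
  by (metis cinner_add_left cinner_commute complex_cnj_add)

lemma Im_cinner: "Im (cinner x y) = (- \<i>) *\<^sub>C x \<bullet> y"
  by (simp add: cinner_scaleC_left flip: Re_cinner)

lemma cinner_eqI: "(\<And>x. cinner x y = cinner x z) \<Longrightarrow> y = z"
  by (metis Re_cinner vector_eq_rdot inner_commute)

lemma norm_scaleC: "norm (c *\<^sub>C x) = cmod c * norm (x::'h::complex_hilbert_space)"
proof -
  have "cinner (c *\<^sub>C x) (c *\<^sub>C x) = c * cnj c * cinner x x"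
    by (simp add: cinner_scaleC_left cinner_scaleC_right mult.assoc)
  then have "complex_of_real ((norm (c *\<^sub>C x))\<^sup>2) = complex_of_real ((cmod c * norm x)\<^sup>2)"
    by (simp add: cinner_self power_mult_distrib flip: power2_norm_eq_inner complex_norm_square)
  then have "(norm (c *\<^sub>C x))\<^sup>2 = (cmod c * norm x)\<^sup>2"
    by (simp only: of_real_eq_iff)
  then show ?thesis
    by (simp add: power2_eq_iff_nonneg)
qed

lemma scaleC_scaleR: "c *\<^sub>C (r *\<^sub>R x) = r *\<^sub>R (c *\<^sub>C (x::'h::complex_hilbert_space))"
  by (simp add: scaleC_scaleC mult.commute flip: scaleC_of_real)

lemma scaleC_zero_right [simp]: "c *\<^sub>C (0::'h::complex_hilbert_space) = 0"
  using scaleC_scaleR[of c 0 "0::'h"] by simp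

lemma scaleC_minus_right: "c *\<^sub>C (- x) = - (c *\<^sub>C (x::'h::complex_hilbert_space))"
  using scaleC_scaleR[of c "-1" x] by simp

lemma scaleC_diff_right: "c *\<^sub>C (x - y) = c *\<^sub>C x - c *\<^sub>C (y::'h::complex_hilbert_space)"
  using scaleC_add_right[of c x "- y"] by (simp add: scaleC_minus_right)

lemma bounded_linear_scaleC: "bounded_linear (\<lambda>x::'h::complex_hilbert_space. c *\<^sub>C x)"
  by (rule bounded_linear_intro[where K = "cmod c"])
     (auto simp: scaleC_add_right scaleC_scaleR norm_scaleC mult.commute)

section \<open>The Banach algebra of bounded operators\<close>

text \<open>
  Making the bounded complex-linear operators a type gives access to the library's theory of Banach
  algebras. The unit is provided by \<^class>\<open>monoid_mult\<close> and not by \<^class>\<open>real_normed_algebra_1\<close>, because on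
  the zero Hilbert space the identity is the zero operator.
\<close>

typedef (overloaded) 'h bop = "{A :: 'h::complex_hilbert_space \<Rightarrow> 'h. bounded_clinear A}"
  morphisms app Bop
  by (rule exI[of _ "\<lambda>x. 0"]) (auto simp: bounded_clinear_def)

setup_lifting type_definition_bop

lemma bounded_linear_app: "bounded_linear (app A)"
  and app_scaleC: "app A (c *\<^sub>C x) = c *\<^sub>C app A x"
  using app[of A] by (auto simp: bounded_clinear_def)

lemmas app_linear = bounded_linear.linear[OF bounded_linear_app]

lemma app_Bop: "bounded_clinear A \<Longrightarrow> app (Bop A) = A"
  by (simp add: Bop_inverse)

lemma bop_eqI: "(\<And>x. app A x = app B x) \<Longrightarrow> A = B"
  by (metis app_inject ext)

instantiation bop :: (complex_hilbert_space) real_normed_vector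
begin

lift_definition zero_bop :: "'a bop" is "\<lambda>x. 0"
  by (auto simp: bounded_clinear_def)

lift_definition plus_bop :: "'a bop \<Rightarrow> 'a bop \<Rightarrow> 'a bop" is "\<lambda>A B x. A x + B x"
  by (auto simp: bounded_clinear_def scaleC_add_right bounded_linear_add)

lift_definition minus_bop :: "'a bop \<Rightarrow> 'a bop \<Rightarrow> 'a bop" is "\<lambda>A B x. A x - B x"
  by (auto simp: bounded_clinear_def scaleC_diff_right bounded_linear_sub)

lift_definition uminus_bop :: "'a bop \<Rightarrow> 'a bop" is "\<lambda>A x. - A x"
  by (auto simp: bounded_clinear_def scaleC_minus_right bounded_linear_minus)

lift_definition scaleR_bop :: "real \<Rightarrow> 'a bop \<Rightarrow> 'a bop" is "\<lambda>r A x. r *\<^sub>R A x"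
  by (auto simp: bounded_clinear_def scaleC_scaleR bounded_linear_const_scaleR)

lift_definition norm_bop :: "'a bop \<Rightarrow> real" is onorm .

definition dist_bop :: "'a bop \<Rightarrow> 'a bop \<Rightarrow> real" where
  "dist_bop A B = norm (A - B)"

definition
  "(uniformity :: ('a bop \<times> 'a bop) filter) = (INF e\<in>{0 <..}. principal {(x, y). dist x y < e})"

definition open_bop :: "'a bop set \<Rightarrow> bool" where
  "open_bop S = (\<forall>x\<in>S. \<forall>\<^sub>F (x', y) in uniformity. x' = x \<longrightarrow> y \<in> S)"

definition sgn_bop :: "'a bop \<Rightarrow> 'a bop" where
  "sgn_bop A = scaleR (inverse (norm A)) A"

instance
proof
  fix A B :: "'a bop" and r :: real
  show "dist A B = norm (A - B)" by (rule dist_bop_def)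
  show "sgn A = scaleR (inverse (norm A)) A" by (rule sgn_bop_def)
  show "(norm A = 0) = (A = 0)"
    by transfer (auto simp: bounded_clinear_def onorm_eq_0 fun_eq_iff)
  show "norm (A + B) \<le> norm A + norm B"
    by transfer (auto simp: bounded_clinear_def intro: onorm_triangle)
  show "norm (r *\<^sub>R A) = \<bar>r\<bar> * norm A"
    by transfer (auto simp: bounded_clinear_def intro: onorm_scaleR)
qed (transfer; simp add: fun_eq_iff scaleR_add_left scaleR_add_right algebra_simps
       uniformity_bop_def open_bop_def; fail
    | simp add: uniformity_bop_def open_bop_def)+

end

lemmas app_simps [simp] = zero_bop.rep_eq plus_bop.rep_eq minus_bop.rep_eq uminus_bop.rep_eq
  scaleR_bop.rep_eq

lemma norm_app_le: "norm (app A x) \<le> norm A * norm x"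
  by (simp add: norm_bop.rep_eq onorm[OF bounded_linear_app])

lemma norm_bop_bound: "0 \<le> b \<Longrightarrow> (\<And>x. norm (app A x) \<le> b * norm x) \<Longrightarrow> norm A \<le> b"
  by (simp add: norm_bop.rep_eq onorm_bound)

instantiation bop :: (complex_hilbert_space) "{real_normed_algebra, monoid_mult}"
begin

lift_definition times_bop :: "'a bop \<Rightarrow> 'a bop \<Rightarrow> 'a bop" is "(\<circ>)"
  by (auto simp: bounded_clinear_def comp_def bounded_linear_compose)

lift_definition one_bop :: "'a bop" is id
  by (auto simp: bounded_clinear_def id_def)

instance
proof
  fix A B :: "'a bop"
  show "norm (A * B) \<le> norm A * norm B"
    by transfer (auto simp: bounded_clinear_def onorm_compose)
qed (transfer; simp add: fun_eq_iff bounded_clinear_def linear_simps; fail)+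

end

lemma app_mult [simp]: "app (A * B) x = app A (app B x)"
  by (simp add: times_bop.rep_eq)

lemma app_one [simp]: "app 1 x = x"
  by (simp add: one_bop.rep_eq)

instance bop :: (complex_hilbert_space) banach
proof
  fix X :: "nat \<Rightarrow> 'a bop"
  assume X: "Cauchy X"
  have bl: "blinfun_apply (Blinfun (app A)) = app A" for A :: "'a bop"
    by (simp add: bounded_linear_Blinfun_apply bounded_linear_app)
  have dist: "dist (Blinfun (app A)) (Blinfun (app B)) = dist A B" for A B :: "'a bop"
    by (simp add: dist_norm norm_bop.rep_eq norm_blinfun.rep_eq minus_blinfun.rep_eq bl)
  have "Cauchy (\<lambda>n. Blinfun (app (X n)))"
    using X by (simp add: Cauchy_def dist)
  then obtain L where L: "(\<lambda>n. Blinfun (app (X n))) \<longlonglongrightarrow> L"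
    using Cauchy_convergent convergent_def by blast
  \<comment> \<open>The limit exists in the real-linear operators; complex-linearity survives pointwise limits.\<close>
  have ptw: "(\<lambda>n. app (X n) x) \<longlonglongrightarrow> blinfun_apply L x" for x
    using bounded_linear.tendsto[OF blinfun.bounded_linear_left L, of x] by (simp add: bl)
  have "blinfun_apply L (c *\<^sub>C x) = c *\<^sub>C blinfun_apply L x" for c x
    using bounded_linear.tendsto[OF bounded_linear_scaleC ptw[of x], of c] ptw[of "c *\<^sub>C x"]
    by (simp add: app_scaleC LIMSEQ_unique)
  then have "bounded_clinear (blinfun_apply L)"
    by (simp add: bounded_clinear_def blinfun.bounded_linear_right)
  then have "app (Bop (blinfun_apply L)) = blinfun_apply L"
    by (rule app_Bop)
  then have "Blinfun (app (Bop (blinfun_apply L))) = L"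
    by (simp add: blinfun_apply_inverse)
  then have "X \<longlonglongrightarrow> Bop (blinfun_apply L)"
    using L dist[of _ "Bop (blinfun_apply L)"] by (simp add: LIMSEQ_def)
  then show "convergent X"
    by (auto simp: convergent_def)
qed

text \<open>
  Complex scalars act as central elements of the algebra, so that identities with complex coefficients
  are ring identities.
\<close>

lift_definition scalar :: "complex \<Rightarrow> 'h::complex_hilbert_space bop" is "\<lambda>c x. c *\<^sub>C x"
  by (auto simp: bounded_clinear_def bounded_linear_scaleC scaleC_scaleC mult.commute)

lemma app_scalar [simp]: "app (scalar c) x = c *\<^sub>C x"
  by (simp add: scalar.rep_eq)

lemma scalar_commute: "A * scalar c = scalar c * A"
  by (rule bop_eqI) (simp add: app_scaleC)

lemma scalar_add: "scalar (c + d) = scalar c + scalar d"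
  by (rule bop_eqI) (simp add: scaleC_add_left)

lemma scalar_mult: "scalar (c * d) = scalar c * scalar d"
  by (rule bop_eqI) (simp add: scaleC_scaleC)

lemma scalar_of_real: "scalar (complex_of_real r) = r *\<^sub>R 1"
  by (rule bop_eqI) (simp add: scaleC_of_real)

lemma scalar_0 [simp]: "scalar 0 = 0" and scalar_1 [simp]: "scalar 1 = 1"
  using scalar_of_real[of 0] scalar_of_real[of 1] by auto

lemma scalar_minus: "scalar (- c) = - scalar c"
  using scalar_add[of c "- c"] by (simp add: eq_neg_iff_add_eq_0 add.commute)

lemma norm_scalar_mult_le: "norm (scalar c * A) \<le> cmod c * norm A"
proof (rule norm_bop_bound)
  fix x
  show "norm (app (scalar c * A) x) \<le> cmod c * norm A * norm x"
    using mult_left_mono[OF norm_app_le[of A x] norm_ge_zero[of c]]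
    by (simp add: norm_scaleC mult.assoc)
qed simp

section \<open>Adjoints\<close>

text \<open>
  The hypothesis on \<open>J\<close> is the parallelogram law for a functional of the form norm square plus affine:
  two points where \<open>J\<close> is almost minimal are close, since otherwise their midpoint would do better.
\<close>

lemma Cauchy_minimizing_sequence:
  fixes X :: "nat \<Rightarrow> 'h::real_inner"
  assumes par: "\<And>x y. J ((1/2) *\<^sub>R (x + y)) + (norm (x - y))\<^sup>2 / 4 \<le> (J x + J y) / 2"
    and low: "\<And>x. m \<le> J x" and X: "\<And>n. J (X n) < m + 1 / Suc n"
  shows "Cauchy X"
proof (rule metric_CauchyI)
  fix e :: real assume e: "e > 0"
  obtain N where N: "1 / Suc N < e\<^sup>2 / 4"
    using nat_approx_posE[of "e\<^sup>2 / 4"] e by (metis divide_pos_pos inverse_eq_divide zero_less_numeral zero_less_power)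
  have "dist (X i) (X j) < e" if "N \<le> i" "N \<le> j" for i j
  proof -
    have "1 / Suc i \<le> 1 / Suc N" "1 / Suc j \<le> 1 / Suc N"
      using that by (auto intro: divide_left_mono)
    then have "(norm (X i - X j))\<^sup>2 < e\<^sup>2"
      using par[of "X i" "X j"] low[of "(1/2) *\<^sub>R (X i + X j)"] X[of i] X[of j] N by argo
    then show ?thesis
      using e by (simp add: dist_norm power_less_imp_less_base)
  qed
  then show "\<exists>N. \<forall>i\<ge>N. \<forall>j\<ge>N. dist (X i) (X j) < e" by blast
qed

text \<open>
  The representing vector is the minimizer of \<open>\<parallel>x\<parallel>\<^sup>2 - 2 \<phi> x\<close>; the functional equation is the vanishing
  of the first variation at the minimum.
\<close>

lemma Riesz_representation:
  fixes \<phi> :: "'h::{real_inner, banach} \<Rightarrow> real"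
  assumes "bounded_linear \<phi>"
  obtains b where "\<And>x. \<phi> x = x \<bullet> b"
proof -
  interpret \<phi>: bounded_linear \<phi> by fact
  define J where "J x = (norm x)\<^sup>2 - 2 * \<phi> x" for x
  define m where "m = Inf (range J)"
  obtain K where K: "\<And>x. norm (\<phi> x) \<le> norm x * K"
    using \<phi>.bounded by blast
  have "J x \<ge> - K\<^sup>2" for x
    using K[of x] zero_le_power2[of "norm x - K"]
    by (simp add: J_def power2_eq_square algebra_simps abs_le_iff)
  then have bdd: "bdd_below (range J)"
    by (rule bdd_belowI2)
  have low: "m \<le> J x" for x
    unfolding m_def using bdd by (auto intro: cInf_lower)
  have par: "J ((1/2) *\<^sub>R (x + y)) + (norm (x - y))\<^sup>2 / 4 \<le> (J x + J y) / 2" for x y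
    by (simp add: J_def power2_norm_eq_inner \<phi>.add \<phi>.scaleR inner_add_left inner_add_right
        inner_diff_left inner_diff_right inner_commute[of y x] field_simps)
  have "\<exists>x. J x < m + 1 / Suc n" for n
  proof -
    have "Inf (range J) < m + 1 / Suc n" by (simp add: m_def)
    then show ?thesis
      using cInf_lessD[of "range J" "m + 1 / Suc n"] by blast
  qed
  then obtain X where X: "\<And>n. J (X n) < m + 1 / Suc n" by metis
  have "Cauchy X"
    using par low X by (rule Cauchy_minimizing_sequence)
  then obtain b where b: "X \<longlonglongrightarrow> b"
    using Cauchy_convergent convergent_def by blast
  have "(\<lambda>n. J (X n)) \<longlonglongrightarrow> J b"
    unfolding J_def by (intro tendsto_intros b \<phi>.tendsto)
  moreover have "(\<lambda>n. m + 1 / Suc n) \<longlonglongrightarrow> m + 0"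
    by (intro tendsto_intros LIMSEQ_Suc lim_1_over_n)
  ultimately have "J b \<le> m + 0"
    by (rule LIMSEQ_le) (use X less_imp_le in blast)
  then have Jb: "J b \<le> m" by simp
  have "\<phi> x = x \<bullet> b" for x
  proof (rule ccontr)
    assume ne: "\<phi> x \<noteq> x \<bullet> b"
    define d where "d = \<phi> x - x \<bullet> b"
    \<comment> \<open>Any sufficiently short step with the sign of \<open>d\<close> lowers \<open>J\<close>; this length avoids the case \<open>x = 0\<close>.\<close>
    define t where "t = d / ((norm x)\<^sup>2 + 1)"
    have J_expand: "J (b + t *\<^sub>R x) = J b + t\<^sup>2 * (norm x)\<^sup>2 - 2 * t * d"
    proof -
      have "(norm (b + t *\<^sub>R x))\<^sup>2 = (norm b)\<^sup>2 + 2 * t * (x \<bullet> b) + t\<^sup>2 * (norm x)\<^sup>2"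
        by (simp add: power2_norm_eq_inner inner_add_left inner_add_right inner_commute[of b x]
            power2_eq_square[of t] distrib_left)
      then show ?thesis
        by (simp add: J_def d_def \<phi>.add \<phi>.scaleR right_diff_distrib)
    qed
    have "t * ((norm x)\<^sup>2 + 1) = d"
      using sum_power2_gt_zero_iff[of 1 "norm x"] by (simp add: t_def add_nonneg_eq_0_iff)
    then have "t\<^sup>2 * (norm x)\<^sup>2 - 2 * t * d = - (t * d) - t\<^sup>2"
      by (auto simp: power2_eq_square algebra_simps)
    moreover have "t * d \<ge> 0"
      by (simp add: t_def)
    moreover have "t \<noteq> 0"
      using ne by (simp add: t_def d_def add_nonneg_eq_0_iff)
    ultimately have "J (b + t *\<^sub>R x) < J b"
      using J_expand zero_less_power2[of t] by linarith
    then show False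
      using low[of "b + t *\<^sub>R x"] Jb by linarith
  qed
  then show ?thesis using that by blast
qed

text \<open>
  Riesz is applied to the real inner product. Complex linearity of the operator recovers the imaginary
  part of the identity, because \<open>Im \<langle>u, v\<rangle> = Re \<langle>-\<i> u, v\<rangle>\<close>.
\<close>

lemma adjoint_exists:
  obtains B where "\<And>x y. cinner (app A x) y = cinner x (app B y)"
proof -
  have "\<exists>b. \<forall>x. app A x \<bullet> y = x \<bullet> b" for y
    using Riesz_representation[of "\<lambda>x. app A x \<bullet> y"]
      bounded_linear_inner_left_comp[OF bounded_linear_app] by metis
  then obtain B where B: "app A x \<bullet> y = x \<bullet> B y" for x y by metis
  have adj: "cinner (app A x) y = cinner x (B y)" for x y
    using B[of x y] B[of "(- \<i>) *\<^sub>C x" y]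
    by (simp add: complex_eq_iff Re_cinner Im_cinner app_scaleC)
  have add: "B (x + y) = B x + B y" for x y
    by (rule cinner_eqI)
      (metis adj cinner_add_left cinner_commute complex_cnj_add)
  have scal: "B (c *\<^sub>C x) = c *\<^sub>C B x" for c x
    by (rule cinner_eqI) (metis adj cinner_scaleC_right)
  have "norm (B y) \<le> norm y * norm A" for y
  proof -
    have "(norm (B y))\<^sup>2 = app A (B y) \<bullet> y"
      by (simp add: B power2_norm_eq_inner)
    also have "\<dots> \<le> norm (app A (B y)) * norm y"
      by (rule norm_cauchy_schwarz)
    also have "\<dots> \<le> norm A * norm (B y) * norm y"
      by (intro mult_right_mono norm_app_le) auto
    finally show ?thesis
      by (cases "norm (B y) = 0") (auto simp: power2_eq_square mult.commute mult.left_commute)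
  qed
  then have "bounded_clinear B"
    unfolding bounded_clinear_def
    using add scal by (metis bounded_linear_intro scaleC_of_real)
  with adj show ?thesis
    using that by (metis app_Bop)
qed

definition star :: "'h::complex_hilbert_space bop \<Rightarrow> 'h bop" where
  "star A = Bop (adj (app A))"

lemma app_star: "app (star A) = adj (app A)"
  and cinner_star: "cinner (app A x) y = cinner x (app (star A) y)"
proof -
  obtain B where B: "\<And>x y. cinner (app A x) y = cinner x (app B y)"
    using adjoint_exists by blast
  have "adj (app A) = app B"
    unfolding adj_def
  proof (rule the_equality)
    fix B' assume "\<forall>x y. cinner (app A x) y = cinner x (B' y)"
    then show "B' = app B"
      using B by (intro ext cinner_eqI) metis
  qed (use B in blast)
  then have "star A = B" "adj (app A) = app B"
    by (auto simp: star_def app_inverse)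
  then show "app (star A) = adj (app A)" "cinner (app A x) y = cinner x (app (star A) y)"
    using B by auto
qed

lemma star_unique: "(\<And>x y. cinner (app A x) y = cinner x (app B y)) \<Longrightarrow> star A = B"
  by (rule bop_eqI, rule cinner_eqI) (metis cinner_star)

lemma inner_star: "app A x \<bullet> y = x \<bullet> app (star A) y"
  by (metis Re_cinner cinner_star)

lemma star_star [simp]: "star (star A) = A"
  by (rule star_unique) (metis cinner_star cinner_commute)

lemma star_mult: "star (A * B) = star B * star A"
  by (rule star_unique) (simp add: cinner_star)

lemma star_one [simp]: "star 1 = 1"
  by (rule star_unique) simp

lemma star_scalar: "star (scalar c) = scalar (cnj c)"
  by (rule star_unique) (simp add: cinner_scaleC_left cinner_scaleC_right)

lemma star_add: "star (A + B) = star A + star B"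
  by (rule star_unique) (simp add: cinner_add_left cinner_add_right cinner_star)

lemma star_scaleR: "star (r *\<^sub>R A) = r *\<^sub>R star A"
proof -
  have "star (scalar (complex_of_real r) * A) = star A * scalar (complex_of_real r)"
    by (simp add: star_mult star_scalar)
  then show ?thesis
    by (simp add: scalar_of_real)
qed

lemma norm_sq_star: "(norm (app A x))\<^sup>2 = x \<bullet> app (star A * A) x"
  by (simp add: power2_norm_eq_inner inner_star)

text \<open>
  The nontrivial half of the C*-identity.
\<close>

lemma norm_star_mult: "norm (star A * A) \<ge> (norm A)\<^sup>2"
proof -
  have "(norm (app A x))\<^sup>2 \<le> (sqrt (norm (star A * A)) * norm x)\<^sup>2" for x
  proof -
    have "(norm (app A x))\<^sup>2 \<le> norm x * norm (app (star A * A) x)"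
      unfolding norm_sq_star by (rule norm_cauchy_schwarz)
    also have "\<dots> \<le> norm x * (norm (star A * A) * norm x)"
      by (intro mult_left_mono norm_app_le) auto
    finally show ?thesis
      by (simp add: power_mult_distrib power2_eq_square mult_ac)
  qed
  then have "norm A \<le> sqrt (norm (star A * A))"
    by (intro norm_bop_bound) (auto intro: power2_le_imp_le)
  then show ?thesis
    by (simp add: real_le_rsqrt sqrt_ge_absD)
qed

lemma norm_star_le: "norm (star A) \<le> norm A"
proof -
  have "norm (star A) ^ 2 \<le> norm A * norm (star A)"
    using norm_star_mult[of "star A"] norm_mult_ineq[of A "star A"] by simp
  then show ?thesis
    by (cases "norm (star A) = 0") (auto simp: power2_eq_square)
qed

lemma bounded_linear_star: "bounded_linear star"
  by (rule bounded_linear_intro[where K = 1]) (simp_all add: star_add star_scaleR norm_star_le)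

section \<open>Invertibility\<close>

definition bop_unit :: "'h::complex_hilbert_space bop \<Rightarrow> bool" where
  "bop_unit A \<longleftrightarrow> (\<exists>B. A * B = 1 \<and> B * A = 1)"

lemma bop_unit_iff: "bop_unit A \<longleftrightarrow> invertible_op (app A)"
proof
  assume "bop_unit A"
  then obtain B where "A * B = 1" "B * A = 1"
    by (auto simp: bop_unit_def)
  then have "app A \<circ> app B = id" "app B \<circ> app A = id"
    by (metis one_bop.rep_eq times_bop.rep_eq)+
  then show "invertible_op (app A)"
    unfolding invertible_op_def using app by blast
next
  assume "invertible_op (app A)"
  then obtain B where B: "bounded_clinear B" "app A \<circ> B = id" "B \<circ> app A = id"
    by (auto simp: invertible_op_def)
  then have "A * Bop B = 1" "Bop B * A = 1"
    by (auto intro!: bop_eqI simp: app_Bop fun_eq_iff)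
  then show "bop_unit A"
    by (auto simp: bop_unit_def)
qed

lemma bop_unit_mult: "bop_unit A \<Longrightarrow> bop_unit B \<Longrightarrow> bop_unit (A * B)"
  unfolding bop_unit_def by (metis mult.assoc mult_1_right)

lemma bop_unit_scalar: "c \<noteq> 0 \<Longrightarrow> bop_unit (scalar c)"
  unfolding bop_unit_def by (rule exI[of _ "scalar (inverse c)"]) (simp flip: scalar_mult)

lemma bop_unit_bounded_below:
  assumes "bop_unit A"
  obtains c where "c > 0" "\<And>x. c * norm x \<le> norm (app A x)"
proof -
  obtain B where B: "B * A = 1"
    using assms by (auto simp: bop_unit_def)
  have "norm x \<le> (norm B + 1) * norm (app A x)" for x
  proof -
    have "norm x = norm (app B (app A x))"
      using B by (metis app_mult app_one)
    also have "\<dots> \<le> norm B * norm (app A x)"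
      by (rule norm_app_le)
    also have "\<dots> \<le> (norm B + 1) * norm (app A x)"
      by (intro mult_right_mono) auto
    finally show ?thesis .
  qed
  then have "1 / (norm B + 1) * norm x \<le> norm (app A x)" for x
    using add_nonneg_pos[of "norm B" 1] by (simp add: pos_divide_le_eq mult.commute)
  moreover have "1 / (norm B + 1) > 0"
    by (simp add: add_nonneg_pos)
  ultimately show ?thesis
    using that by blast
qed

text \<open>
  For small \<open>t > 0\<close> coercivity makes \<open>N = 1 - t A\<close> a strict contraction of the Hilbert space, so that left and
  right inverses of \<open>A\<close> are fixed points of the contractions \<open>X \<mapsto> N X + t\<close> and \<open>X \<mapsto> X N + t\<close> of the
  operator algebra. Working with operators makes the inverse bounded and linear for free.
\<close>

lemma Lax_Milgram:
  assumes c: "c > 0" and coercive: "\<And>x. c * (norm x)\<^sup>2 \<le> x \<bullet> app A x"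
  shows "bop_unit A"
proof -
  \<comment> \<open>\<open>\<parallel>N x\<parallel>\<^sup>2 \<le> (1 - 2 t c + t\<^sup>2 \<parallel>A\<parallel>\<^sup>2) \<parallel>x\<parallel>\<^sup>2\<close>, and \<open>t\<^sup>2 \<parallel>A\<parallel>\<^sup>2 \<le> t c\<close>. The summand \<open>c\<^sup>2\<close> in \<open>m\<close> ensures \<open>t c \<le> 1\<close>.\<close>
  define m where "m = (norm A)\<^sup>2 + c\<^sup>2"
  define t where "t = c / m"
  define N where "N = 1 - t *\<^sub>R A"
  define q where "q = sqrt (1 - t * c)"
  have m: "m > 0" "c\<^sup>2 \<le> m" "(norm A)\<^sup>2 \<le> m"
    using c by (auto simp: m_def add_nonneg_pos)
  have t: "t > 0" "t * m = c"
    using c m by (auto simp: t_def)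
  have tc: "t * c \<le> 1" "t * c > 0"
    using c m by (auto simp: t_def power2_eq_square)
  have q: "0 \<le> q" "q < 1"
    using tc by (auto simp: q_def)
  have "norm N \<le> q"
  proof (rule norm_bop_bound)
    fix x
    have "(norm (app A x))\<^sup>2 \<le> (norm A * norm x)\<^sup>2"
      by (intro power_mono norm_app_le) auto
    also have "\<dots> \<le> m * (norm x)\<^sup>2"
      unfolding power_mult_distrib using m by (intro mult_right_mono) auto
    finally have A: "(norm (app A x))\<^sup>2 \<le> m * (norm x)\<^sup>2" .
    have "t\<^sup>2 * (norm (app A x))\<^sup>2 \<le> t\<^sup>2 * (m * (norm x)\<^sup>2)"
      using A by (rule mult_left_mono) auto
    also have "\<dots> = t * c * (norm x)\<^sup>2"
      using t(2) by (metis mult.assoc power2_eq_square)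
    finally have 1: "t\<^sup>2 * (norm (app A x))\<^sup>2 \<le> t * c * (norm x)\<^sup>2" .
    have 2: "t * (c * (norm x)\<^sup>2) \<le> t * (x \<bullet> app A x)"
      using t coercive by (intro mult_left_mono) auto
    have "(norm (app N x))\<^sup>2 = (norm x)\<^sup>2 - 2 * (t * (x \<bullet> app A x)) + t\<^sup>2 * (norm (app A x))\<^sup>2"
      by (simp add: N_def power2_norm_eq_inner inner_diff_left inner_diff_right
          inner_commute[of "app A x" x] power2_eq_square[of t]
          right_diff_distrib)
    also have "\<dots> \<le> (norm x)\<^sup>2 - t * c * (norm x)\<^sup>2"
      using 1 2 by (simp add: mult.assoc)
    also have "\<dots> = (q * norm x)\<^sup>2"
      using tc by (simp add: q_def power_mult_distrib left_diff_distrib)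
    finally show "norm (app N x) \<le> q * norm x"
      by (rule power2_le_imp_le) (use q in simp)
  qed (rule q)
  then have "norm (N * X) \<le> q * norm X" "norm (X * N) \<le> q * norm X" for X
    using norm_mult_ineq[of N X] norm_mult_ineq[of X N] mult_right_mono[of "norm N" q "norm X"]
      mult_left_mono[of "norm N" q "norm X"] by (simp_all add: mult.commute)
  then have N: "dist (N * X + t *\<^sub>R 1) (N * Y + t *\<^sub>R 1) \<le> q * dist X Y"
    "dist (X * N + t *\<^sub>R 1) (Y * N + t *\<^sub>R 1) \<le> q * dist X Y" for X Y
    by (simp_all add: dist_norm flip: right_diff_distrib left_diff_distrib)
  have "\<exists>!X. N * X + t *\<^sub>R 1 = X"
    using banach_fix_type[of q "\<lambda>X. N * X + t *\<^sub>R 1"] q N by blast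
  then obtain X where "N * X + t *\<^sub>R 1 = X" by blast
  then have X: "A * X = 1"
    using t by (simp add: N_def left_diff_distrib flip: scaleR_right_diff_distrib)
  have "\<exists>!X. X * N + t *\<^sub>R 1 = X"
    using banach_fix_type[of q "\<lambda>X. X * N + t *\<^sub>R 1"] q N by blast
  then obtain Y where "Y * N + t *\<^sub>R 1 = Y" by blast
  then have Y: "Y * A = 1"
    using t by (simp add: N_def right_diff_distrib flip: scaleR_right_diff_distrib)
  have "X = Y"
    using X Y by (metis mult.assoc mult_1_left mult_1_right)
  then show ?thesis
    using X Y by (auto simp: bop_unit_def)
qed

section \<open>Polynomials of operators and the spectrum\<close>

text \<open>
  Horner's scheme, which makes the algebraic rules provable by induction over the coefficients.
\<close>

definition bpoly :: "complex poly \<Rightarrow> 'h::complex_hilbert_space bop \<Rightarrow> 'h bop" where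
  "bpoly p A = fold_coeffs (\<lambda>a B. scalar a + A * B) p 0"

lemma bpoly_0 [simp]: "bpoly 0 A = 0"
  by (simp add: bpoly_def)

lemma bpoly_pCons [simp]: "bpoly (pCons a p) A = scalar a + A * bpoly p A"
  by (cases "p = 0 \<and> a = 0") (auto simp: bpoly_def)

lemma bpoly_altdef: "bpoly p A = (\<Sum>i\<le>degree p. scalar (coeff p i) * A ^ i)"
proof (induction p rule: pCons_induct)
  case (pCons a p)
  show ?case
  proof (cases "p = 0")
    case False
    have "bpoly (pCons a p) A = scalar a + (\<Sum>i\<le>degree p. A * (scalar (coeff p i) * A ^ i))"
      by (simp add: pCons.IH sum_distrib_left)
    also have "\<dots> = scalar (coeff (pCons a p) 0) * A ^ 0
        + (\<Sum>i\<le>degree p. scalar (coeff (pCons a p) (Suc i)) * A ^ Suc i)"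
      by (simp add: scalar_commute[of A] mult.assoc flip: mult.assoc[of A])
    also have "\<dots> = (\<Sum>i\<le>degree (pCons a p). scalar (coeff (pCons a p) i) * A ^ i)"
      unfolding degree_pCons_eq[OF False] sum.atMost_Suc_shift ..
    finally show ?thesis .
  qed simp
qed simp

lemma app_sum: "app (sum f I) x = (\<Sum>i\<in>I. app (f i) x)"
  by (induction I rule: infinite_finite_induct) auto

lemma app_power: "app (A ^ n) x = (app A ^^ n) x"
  by (induction n arbitrary: x) (auto simp: funpow_swap1)

lemma app_bpoly: "app (bpoly p A) = op_poly p (app A)"
  by (rule ext) (simp add: bpoly_altdef op_poly_def app_sum app_power)

lemma bpoly_add: "bpoly (p + q) A = bpoly p A + bpoly q A"
  by (induction p q rule: poly_induct2) (auto simp: scalar_add distrib_left)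

lemma bpoly_smult: "bpoly (smult c p) A = scalar c * bpoly p A"
  by (induction p)
    (auto simp: scalar_mult distrib_left scalar_commute[of A] mult.assoc simp flip: mult.assoc[of A])

lemma bpoly_diff: "bpoly (p - q) A = bpoly p A - bpoly q A"
  using bpoly_add[of p "smult (-1) q" A] by (simp only: bpoly_smult) (simp add: scalar_minus)

lemma bpoly_mult: "bpoly (p * q) A = bpoly p A * bpoly q A"
  by (induction p) (auto simp: bpoly_add bpoly_smult distrib_right mult.assoc)

lemma bpoly_commute: "A * bpoly p A = bpoly p A * A"
  by (induction p)
    (auto simp: distrib_left distrib_right scalar_commute simp flip: mult.assoc)

lemma bpoly_similar:
  assumes "S * S' = 1" "S' * S = 1"
  shows "bpoly p (S * A * S') = S * bpoly p A * S'"
proof (induction p)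
  case (pCons a p)
  have "S' * (S * X) = X" for X
    using assms by (metis mult.assoc mult_1_left)
  moreover have "S * (scalar a * S') = scalar a"
    using assms by (metis mult.assoc mult_1_right scalar_commute)
  moreover have "bpoly (pCons a p) (S * A * S') = scalar a + S * A * S' * (S * bpoly p A * S')"
    by (simp add: pCons.IH)
  ultimately show ?case
    by (simp add: distrib_left distrib_right mult.assoc)
qed simp

lemma star_bpoly: "star (bpoly p A) = bpoly (map_poly cnj p) (star A)"
proof (induction p)
  case 0
  then show ?case using star_scaleR[of 0 0] by simp
next
  case (pCons a p)
  then show ?case
    by (simp add: map_poly_pCons star_add star_mult star_scalar bpoly_commute)
qed

lemma spectrum_iff: "z \<in> spectrum (app A) \<longleftrightarrow> \<not> bop_unit (A - scalar z)"
proof -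
  have "app (A - scalar z) = (\<lambda>x. app A x - z *\<^sub>C x)" by auto
  then show ?thesis
    by (simp add: spectrum_def bop_unit_iff)
qed

lemma selfadjoint_inner_imaginary:
  assumes "star A = A"
  shows "Im (cinner (app A x) x) = 0"
  using assms by (metis Reals_cnj_iff cinner_commute cinner_star complex_is_Real_iff)

text \<open>
  For self-adjoint \<open>A\<close> the number \<open>\<langle>A x, x\<rangle>\<close> is real, so \<open>\<i> (Im z) (A - z)\<close> is coercive with constant
  \<open>(Im z)\<^sup>2\<close>, hence invertible unless \<open>z\<close> is real.
\<close>

lemma spectrum_selfadjoint_real:
  assumes A: "star A = A" and z: "z \<in> spectrum (app A)"
  shows "Im z = 0"
proof (rule ccontr)
  assume b: "Im z \<noteq> 0"
  define u where "u = \<i> * complex_of_real (Im z)"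
  have u: "u \<noteq> 0" using b by (simp add: u_def)
  have "bop_unit (scalar u * (A - scalar z))"
  proof (rule Lax_Milgram)
    show "(Im z)\<^sup>2 > 0" using b by simp
    fix x
    have "cinner (app (scalar u * (A - scalar z)) x) x = u * (cinner (app A x) x - z * cinner x x)"
      by (simp add: cinner_scaleC_left cinner_diff_left)
    then have "x \<bullet> app (scalar u * (A - scalar z)) x = (Im z)\<^sup>2 * (norm x)\<^sup>2"
      using selfadjoint_inner_imaginary[OF A, of x]
      by (subst inner_commute, subst Re_cinner[symmetric])
        (simp add: u_def cinner_self power2_eq_square[of "Im z"] power2_norm_eq_inner)
    then show "(Im z)\<^sup>2 * (norm x)\<^sup>2 \<le> x \<bullet> app (scalar u * (A - scalar z)) x"
      by simp
  qed
  then have "bop_unit (scalar (inverse u) * (scalar u * (A - scalar z)))"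
    by (rule bop_unit_mult[OF bop_unit_scalar, rotated]) (use u in simp)
  moreover have "scalar (inverse u) * (scalar u * (A - scalar z)) = A - scalar z"
    using u by (simp flip: scalar_mult mult.assoc)
  ultimately have "bop_unit (A - scalar z)" by simp
  then show False
    using z by (simp add: spectrum_iff)
qed

text \<open>
  For real \<open>z < c\<close> the operator \<open>A - z\<close> is coercive, and for real \<open>z > \<parallel>A\<parallel>\<close> the operator \<open>z - A\<close> is.
\<close>

lemma spectrum_selfadjoint_bounds:
  assumes A: "star A = A" and z: "z \<in> spectrum (app A)"
    and low: "\<And>x. c * (norm x)\<^sup>2 \<le> x \<bullet> app A x"
  shows "z \<in> complex_of_real ` {c..norm A}"
proof -
  have zr: "z = complex_of_real (Re z)"
    using spectrum_selfadjoint_real[OF A z] by (simp add: complex_eq_iff)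
  have "c \<le> Re z"
  proof (rule ccontr)
    assume "\<not> c \<le> Re z"
    then have "bop_unit (A - scalar (complex_of_real (Re z)))"
      by (intro Lax_Milgram[of "c - Re z"])
        (use low in \<open>auto simp: scalar_of_real inner_diff_right power2_norm_eq_inner algebra_simps\<close>)
    then show False using z zr by (simp add: spectrum_iff)
  qed
  moreover have "Re z \<le> norm A"
  proof (rule ccontr)
    assume r: "\<not> Re z \<le> norm A"
    have up: "x \<bullet> app A x \<le> norm A * (norm x)\<^sup>2" for x
      using norm_cauchy_schwarz[of x "app A x"] mult_left_mono[OF norm_app_le[of A x], of "norm x"]
      by (simp add: power2_eq_square mult_ac)
    have "bop_unit (scalar (complex_of_real (Re z)) - A)"
      by (intro Lax_Milgram[of "Re z - norm A"])
        (use r up in \<open>auto simp: scalar_of_real inner_diff_right power2_norm_eq_inner algebra_simps\<close>)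
    then have "bop_unit (scalar (- 1) * (scalar (complex_of_real (Re z)) - A))"
      by (intro bop_unit_mult bop_unit_scalar) auto
    then show False using z zr by (simp add: spectrum_iff scalar_minus)
  qed
  ultimately show ?thesis using zr by auto
qed

text \<open>
  The part of the spectral mapping theorem that comes from splitting \<open>p\<close> into linear factors: a polynomial
  without zeros on the spectrum gives an invertible operator.
\<close>

lemma bpoly_unit:
  assumes "p \<noteq> 0" "\<And>\<alpha>. poly p \<alpha> = 0 \<Longrightarrow> \<alpha> \<notin> spectrum (app A)"
  shows "bop_unit (bpoly p A)"
  using assms
proof (induction "degree p" arbitrary: p rule: less_induct)
  case less
  show ?case
  proof (cases "degree p = 0")
    case True
    then obtain c where "p = [:c:]" by (rule degree_eq_zeroE)
    then show ?thesis using less.prems(1) bop_unit_scalar by auto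
  next
    case False
    then have "\<not> constant (poly p)"
      by (simp add: constant_degree)
    then obtain \<alpha> where \<alpha>: "poly p \<alpha> = 0"
      using fundamental_theorem_of_algebra by blast
    then obtain q where q: "p = [:-\<alpha>, 1:] * q"
      by (metis dvdE poly_eq_0_iff_dvd)
    have "q \<noteq> 0" using q less.prems(1) by auto
    then have "degree p = Suc (degree q)"
      unfolding q by (subst degree_mult_eq) auto
    then have "bop_unit (bpoly q A)"
      using less.hyps[of q] less.prems(2) \<open>q \<noteq> 0\<close> q by auto
    moreover have "bop_unit (bpoly [:-\<alpha>, 1:] A)"
      using less.prems(2)[OF \<alpha>] by (simp add: spectrum_iff scalar_minus)
    ultimately show ?thesis
      unfolding q bpoly_mult by (rule bop_unit_mult[rotated])
  qed
qed

text \<open>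
  If neither \<open>b = \<parallel>A\<parallel>\<close> nor \<open>-b\<close> were in the spectrum, then \<open>A\<^sup>2 - b\<^sup>2\<close> would be bounded below, say
  by \<open>c\<close>. Expanding \<open>\<parallel>A\<^sup>2 x - b\<^sup>2 x\<parallel>\<^sup>2\<close> with \<open>\<parallel>A\<^sup>2 x\<parallel> \<le> b \<parallel>A x\<parallel>\<close> then gives
  \<open>\<parallel>A x\<parallel>\<^sup>2 \<le> (b\<^sup>2 - c\<^sup>2 / b\<^sup>2) \<parallel>x\<parallel>\<^sup>2\<close>, contradicting \<open>\<parallel>A\<parallel> = b\<close>.
\<close>

lemma selfadjoint_norm_in_spectrum:
  assumes A: "star A = A" and nz: "A \<noteq> 0"
  obtains s where "\<bar>s\<bar> = norm A" "complex_of_real s \<in> spectrum (app A)"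
proof -
  define b where "b = norm A"
  have b: "b > 0" using nz by (simp add: b_def)
  have "complex_of_real b \<in> spectrum (app A) \<or> complex_of_real (- b) \<in> spectrum (app A)"
  proof (rule ccontr)
    assume "\<not> ?thesis"
    then have "bop_unit ((A - scalar (complex_of_real b)) * (A - scalar (complex_of_real (- b))))"
      by (intro bop_unit_mult) (auto simp: spectrum_iff)
    then obtain c0 where c0: "c0 > 0"
      "\<And>x. c0 * norm x \<le> norm (app ((A - scalar (complex_of_real b)) * (A - scalar (complex_of_real (- b)))) x)"
      by (rule bop_unit_bounded_below) blast
    \<comment> \<open>Shrinking the lower bound to at most \<open>b\<^sup>2\<close> keeps the number \<open>k\<close> under the square root nonnegative.\<close>
    define c where "c = min c0 (b\<^sup>2)"
    define k where "k = b\<^sup>2 - c\<^sup>2 / b\<^sup>2"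
    have c: "c > 0" "c \<le> b\<^sup>2" "c \<le> c0" using c0 b by (auto simp: c_def)
    have "c\<^sup>2 \<le> b\<^sup>2 * b\<^sup>2"
      unfolding power2_eq_square[of c] using c by (intro mult_mono) auto
    then have k: "0 \<le> k" "k < b\<^sup>2"
      using b c by (auto simp: k_def divide_le_eq)
    have "norm A \<le> sqrt k"
    proof (rule norm_bop_bound)
      fix x
      have "- complex_of_real b *\<^sub>C y = - (b *\<^sub>R y)" for y :: 'a
        using scaleC_of_real[of "- b" y] by simp
      then have "app ((A - scalar (complex_of_real b)) * (A - scalar (complex_of_real (- b)))) x
          = app A (app A x) - b\<^sup>2 *\<^sub>R x"
        by (simp add: scalar_of_real linear_diff[OF app_linear] linear_add[OF app_linear]
            linear_cmul[OF app_linear] power2_eq_square scaleC_of_real scaleR_add_right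
            linear_neg[OF app_linear])
      then have "c0 * norm x \<le> norm (app A (app A x) - b\<^sup>2 *\<^sub>R x)"
        using c0(2)[of x] by simp
      then have "c * norm x \<le> norm (app A (app A x) - b\<^sup>2 *\<^sub>R x)"
        using c mult_right_mono[of c c0 "norm x"] by (meson norm_ge_zero order_trans)
      then have "(c * norm x)\<^sup>2 \<le> (norm (app A (app A x) - b\<^sup>2 *\<^sub>R x))\<^sup>2"
        using c by (intro power_mono) auto
      also have "\<dots> = (norm (app A (app A x)))\<^sup>2 - 2 * b\<^sup>2 * (app A (app A x) \<bullet> x) + b\<^sup>2 * b\<^sup>2 * (norm x)\<^sup>2"
        by (simp add: power2_norm_eq_inner inner_diff_left inner_diff_right
          inner_commute[of x "app A (app A x)"] right_diff_distrib)
      also have "app A (app A x) \<bullet> x = (norm (app A x))\<^sup>2"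
        using A inner_star[of A "app A x" x] by (simp add: power2_norm_eq_inner)
      finally have 1: "(c * norm x)\<^sup>2 \<le> (norm (app A (app A x)))\<^sup>2
          - 2 * b\<^sup>2 * (norm (app A x))\<^sup>2 + b\<^sup>2 * b\<^sup>2 * (norm x)\<^sup>2" .
      have "(norm (app A (app A x)))\<^sup>2 \<le> (b * norm (app A x))\<^sup>2"
        unfolding b_def by (intro power_mono norm_app_le) auto
      then have "b\<^sup>2 * (norm (app A x))\<^sup>2 \<le> b\<^sup>2 * b\<^sup>2 * (norm x)\<^sup>2 - c\<^sup>2 * (norm x)\<^sup>2"
        using 1 by (simp add: power_mult_distrib)
      also have "\<dots> = b\<^sup>2 * (k * (norm x)\<^sup>2)"
        using b by (simp add: k_def field_simps)
      finally have "(norm (app A x))\<^sup>2 \<le> k * (norm x)\<^sup>2"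
        using b by simp
      also have "\<dots> = (sqrt k * norm x)\<^sup>2"
        using k by (simp add: power_mult_distrib)
      finally show "norm (app A x) \<le> sqrt k * norm x"
        by (rule power2_le_imp_le) (use k in simp)
    qed (use k in simp)
    then have "b \<le> sqrt k" by (simp add: b_def)
    also have "sqrt k < sqrt (b\<^sup>2)" using k by (simp only: real_sqrt_less_iff)
    finally show False using b by simp
  qed
  then show ?thesis
    using that[of b] that[of "- b"] b by (auto simp: b_def)
qed

lemma spectrum_selfadjoint_nonempty:
  assumes "star A = A" and "(1 :: 'h::complex_hilbert_space bop) \<noteq> 0"
  shows "spectrum (app (A :: 'h bop)) \<noteq> {}"
proof (cases "A = 0")
  case True
  then have "\<not> bop_unit (A - scalar 0)"
    using assms(2) by (simp add: bop_unit_def)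
  then show ?thesis
    using spectrum_iff by blast
next
  case False
  then show ?thesis using selfadjoint_norm_in_spectrum[OF assms(1)] by blast
qed

text \<open>
  By the C*-identity it suffices to bound the self-adjoint operator \<open>r(A) = p(A)* p(A)\<close>, whose norm is up to
  sign in its spectrum. The spectral mapping property turns that spectral value into \<open>\<bar>p(\<alpha>)\<bar>\<^sup>2\<close> for some \<open>\<alpha>\<close> in
  the spectrum of \<open>A\<close>.
\<close>

lemma norm_bpoly_le:
  assumes A: "star A = A" and M: "0 \<le> M" "\<And>z. z \<in> spectrum (app A) \<Longrightarrow> cmod (poly p z) \<le> M"
  shows "norm (bpoly p A) \<le> M"
proof -
  define r where "r = map_poly cnj p * p"
  define B where "B = star (bpoly p A) * bpoly p A"
  have B: "B = bpoly r A" "star B = B"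
    by (simp add: B_def r_def star_bpoly A bpoly_mult) (simp add: B_def star_mult)
  have r: "poly r z = complex_of_real ((cmod (poly p z))\<^sup>2)" if "z \<in> spectrum (app A)" for z
  proof -
    have "cnj z = z" using spectrum_selfadjoint_real[OF A that] by (simp add: complex_eq_iff)
    then have "poly (map_poly cnj p) z = cnj (poly p z)"
      using poly_cnj[of p z] by simp
    then show ?thesis
      unfolding r_def poly_mult complex_norm_square by (simp add: mult.commute)
  qed
  have "norm B \<le> M\<^sup>2"
  proof (cases "B = 0")
    case False
    then obtain s where s: "\<bar>s\<bar> = norm B" "complex_of_real s \<in> spectrum (app B)"
      using selfadjoint_norm_in_spectrum B(2) by blast
    have "\<exists>\<alpha>\<in>spectrum (app A). poly r \<alpha> = complex_of_real s"
    proof (cases "r = [:complex_of_real s:]")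
      case True
      \<comment> \<open>A constant \<open>r\<close> has no factorization to use, but takes the value \<open>s\<close> anywhere on the spectrum.\<close>
      have "(1 :: 'a bop) \<noteq> 0"
        using False by (metis mult_1_left mult_zero_left)
      then show ?thesis
        using spectrum_selfadjoint_nonempty[OF A] True by auto
    next
      case neq: False
      have "bpoly (r - [:complex_of_real s:]) A = B - scalar (complex_of_real s)"
        by (simp only: bpoly_diff B bpoly_pCons) simp
      then have "\<not> bop_unit (bpoly (r - [:complex_of_real s:]) A)"
        using s(2) by (simp add: spectrum_iff)
      then show ?thesis
        using bpoly_unit[of "r - [:complex_of_real s:]" A] neq by auto
    qed
    then obtain \<alpha> where "\<alpha> \<in> spectrum (app A)" "poly r \<alpha> = complex_of_real s" by blast
    then have "s = (cmod (poly p \<alpha>))\<^sup>2" "cmod (poly p \<alpha>) \<le> M"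
      using r M(2) of_real_eq_iff by metis+
    then show ?thesis
      using s(1) M(1) by (simp add: power_mono flip: s(1))
  qed simp
  moreover have "(norm (bpoly p A))\<^sup>2 \<le> norm B"
    unfolding B_def by (rule norm_star_mult)
  ultimately show ?thesis
    using M(1) by (meson order_trans power2_le_imp_le)
qed

section \<open>Continuous functional calculus\<close>

text \<open>
  \<open>calc A g B\<close> means \<open>B = g(A)\<close>. As a relation it needs only one approximating sequence of polynomials; for
  self-adjoint \<open>A\<close> all such sequences give the same limit, since the norm of \<open>p(A)\<close> is controlled by the values of \<open>p\<close>
  on the spectrum, and so the relation agrees with \<^const>\<open>cont_fun_calc\<close>.
\<close>

definition calc ::
  "'h::complex_hilbert_space bop \<Rightarrow> (complex \<Rightarrow> complex) \<Rightarrow> 'h bop \<Rightarrow> bool" where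
  "calc A g B \<longleftrightarrow> (\<exists>p. uniform_limit (spectrum (app A)) (\<lambda>n z. poly (p n) z) g sequentially \<and>
     (\<lambda>n. bpoly (p n) A) \<longlonglongrightarrow> B)"

lemma bpoly_limit_unique:
  assumes A: "star A = A"
    and p: "uniform_limit (spectrum (app A)) (\<lambda>n z. poly (p n) z) g sequentially"
    and q: "uniform_limit (spectrum (app A)) (\<lambda>n z. poly (q n) z) g sequentially"
  shows "(\<lambda>n. bpoly (p n) A - bpoly (q n) A) \<longlonglongrightarrow> 0"
proof (rule tendstoI)
  fix e :: real assume e: "e > 0"
  have "\<forall>\<^sub>F n in sequentially. \<forall>z\<in>spectrum (app A). dist (poly (p n) z - poly (q n) z) (g z - g z) < e / 2"
    using uniform_limitD[OF uniform_limit_minus[OF p q], of "e / 2"] e by simp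
  then show "\<forall>\<^sub>F n in sequentially. dist (bpoly (p n) A - bpoly (q n) A) 0 < e"
  proof eventually_elim
    case (elim n)
    then have "norm (bpoly (p n - q n) A) \<le> e / 2"
      by (intro norm_bpoly_le[OF A]) (use e in \<open>auto simp: less_imp_le\<close>)
    then show ?case using e by (simp add: bpoly_diff)
  qed
qed

lemma calc_tendsto:
  assumes "star A = A" "calc A g B"
    and p: "uniform_limit (spectrum (app A)) (\<lambda>n z. poly (p n) z) g sequentially"
  shows "(\<lambda>n. bpoly (p n) A) \<longlonglongrightarrow> B"
proof -
  obtain q where q: "uniform_limit (spectrum (app A)) (\<lambda>n z. poly (q n) z) g sequentially"
    "(\<lambda>n. bpoly (q n) A) \<longlonglongrightarrow> B"
    using assms(2) by (auto simp: calc_def)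
  show ?thesis
    using tendsto_add[OF bpoly_limit_unique[OF assms(1) p q(1)] q(2)] by simp
qed

lemma calc_unique: "star A = A \<Longrightarrow> calc A g B \<Longrightarrow> calc A g C \<Longrightarrow> B = C"
  using calc_tendsto LIMSEQ_unique unfolding calc_def by metis

lemma calc_exists:
  assumes A: "star A = A"
    and p: "uniform_limit (spectrum (app A)) (\<lambda>n z. poly (p n) z) g sequentially"
  obtains B where "calc A g B"
proof -
  have "Cauchy (\<lambda>n. bpoly (p n) A)"
  proof (rule metric_CauchyI)
    fix e :: real assume e: "e > 0"
    then obtain N where N: "dist (poly (p n) z) (g z) < e / 4"
      if "n \<ge> N" "z \<in> spectrum (app A)" for n z
      using uniform_limitD[OF p, of "e / 4"] by (auto simp: eventually_sequentially)
    have "dist (bpoly (p m) A) (bpoly (p n) A) < e" if "m \<ge> N" "n \<ge> N" for m n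
    proof -
      have "cmod (poly (p m - p n) z) \<le> e / 2" if z: "z \<in> spectrum (app A)" for z
        using dist_triangle2[of "poly (p m) z" "poly (p n) z" "g z"]
          N[OF \<open>m \<ge> N\<close> z] N[OF \<open>n \<ge> N\<close> z] by (simp add: dist_norm)
      then have "norm (bpoly (p m - p n) A) \<le> e / 2"
        by (intro norm_bpoly_le[OF A]) (use e in auto)
      then show ?thesis using e by (simp add: dist_norm bpoly_diff)
    qed
    then show "\<exists>N. \<forall>m\<ge>N. \<forall>n\<ge>N. dist (bpoly (p m) A) (bpoly (p n) A) < e" by blast
  qed
  then show ?thesis
    using that p unfolding calc_def Cauchy_convergent_iff convergent_def by blast
qed

lemma cont_fun_calc_eq:
  assumes A: "star A = A" and B: "calc A g B"
  shows "cont_fun_calc g (app A) = app B"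
  unfolding cont_fun_calc_def
proof (rule the_equality, safe)
  have on: "onorm (\<lambda>x. op_poly q (app A) x - app C x) = norm (bpoly q A - C)" for q and C :: "'a bop"
    by (simp add: norm_bop.rep_eq minus_bop.rep_eq app_bpoly)
  show "bounded_clinear (app B)" using app by blast
  show "(\<lambda>n. onorm (\<lambda>x. op_poly (p n) (app A) x - app B x)) \<longlonglongrightarrow> 0"
    if "uniform_limit (spectrum (app A)) (\<lambda>n. poly (p n)) g sequentially" for p
    unfolding on using calc_tendsto[OF A B that] by (simp add: tendsto_norm_zero LIM_zero)
  fix C assume C: "bounded_clinear C" and lim: "\<forall>p. uniform_limit (spectrum (app A)) (\<lambda>n. poly (p n)) g sequentially
    \<longrightarrow> (\<lambda>n. onorm (\<lambda>x. op_poly (p n) (app A) x - C x)) \<longlonglongrightarrow> 0"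
  obtain p where p: "uniform_limit (spectrum (app A)) (\<lambda>n z. poly (p n) z) g sequentially"
    "(\<lambda>n. bpoly (p n) A) \<longlonglongrightarrow> B"
    using B by (auto simp: calc_def)
  have "(\<lambda>n. norm (bpoly (p n) A - Bop C)) \<longlonglongrightarrow> 0"
    using lim p(1) by (simp add: app_Bop[OF C] flip: on)
  then have "(\<lambda>n. bpoly (p n) A) \<longlonglongrightarrow> Bop C"
    by (rule LIM_zero_cancel[OF tendsto_norm_zero_cancel])
  then show "C = app B"
    using p(2) LIMSEQ_unique app_Bop[OF C] by metis
qed

lemma calc_cong:
  assumes "calc A g B" "\<And>z. z \<in> spectrum (app A) \<Longrightarrow> g z = h z"
  shows "calc A h B"
proof -
  obtain p where p: "uniform_limit (spectrum (app A)) (\<lambda>n z. poly (p n) z) g sequentially"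
    "(\<lambda>n. bpoly (p n) A) \<longlonglongrightarrow> B"
    using assms(1) by (auto simp: calc_def)
  have "uniform_limit (spectrum (app A)) (\<lambda>n z. poly (p n) z) h sequentially"
    using p(1) assms(2) by (simp add: uniform_limit_iff cong: ball_cong)
  with p(2) show ?thesis
    unfolding calc_def by (intro exI[of _ p] conjI)
qed

lemma calc_poly: "calc A (poly p) (bpoly p A)"
  unfolding calc_def by (rule exI[of _ "\<lambda>n. p"]) (simp add: uniform_limit_const)

lemma calc_linear:
  assumes "calc A g B" "calc A h C"
  shows "calc A (\<lambda>z. g z + c * h z) (B + scalar c * C)"
proof -
  obtain p q where p: "uniform_limit (spectrum (app A)) (\<lambda>n z. poly (p n) z) g sequentially"
    "(\<lambda>n. bpoly (p n) A) \<longlonglongrightarrow> B"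
    and q: "uniform_limit (spectrum (app A)) (\<lambda>n z. poly (q n) z) h sequentially"
    "(\<lambda>n. bpoly (q n) A) \<longlonglongrightarrow> C"
    using assms by (auto simp: calc_def)
  have "uniform_limit (spectrum (app A)) (\<lambda>n z. c * poly (q n) z) (\<lambda>z. c * h z) sequentially"
    by (rule bounded_linear.uniform_limit[OF bounded_linear_mult_right q(1)])
  then have "uniform_limit (spectrum (app A)) (\<lambda>n z. poly (p n + smult c (q n)) z)
      (\<lambda>z. g z + c * h z) sequentially"
    using p by (simp add: uniform_limit_add)
  moreover have "(\<lambda>n. bpoly (p n + smult c (q n)) A) \<longlonglongrightarrow> B + scalar c * C"
    unfolding bpoly_add bpoly_smult by (intro tendsto_intros p q)
  ultimately show ?thesis
    unfolding calc_def by (intro exI[of _ "\<lambda>n. p n + smult c (q n)"] conjI)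
qed

lemma calc_mult:
  assumes "calc A g B" "calc A h C"
    and "bounded (g ` spectrum (app A))" "bounded (h ` spectrum (app A))"
  shows "calc A (\<lambda>z. g z * h z) (B * C)"
proof -
  obtain p q where "uniform_limit (spectrum (app A)) (\<lambda>n z. poly (p n) z) g sequentially"
    "(\<lambda>n. bpoly (p n) A) \<longlonglongrightarrow> B"
    "uniform_limit (spectrum (app A)) (\<lambda>n z. poly (q n) z) h sequentially"
    "(\<lambda>n. bpoly (q n) A) \<longlonglongrightarrow> C"
    using assms by (auto simp: calc_def)
  then have "uniform_limit (spectrum (app A)) (\<lambda>n z. poly (p n * q n) z) (\<lambda>z. g z * h z) sequentially"
    "(\<lambda>n. bpoly (p n * q n) A) \<longlonglongrightarrow> B * C"
    unfolding poly_mult bpoly_mult using assms(3,4) by (auto intro: uniform_lim_mult tendsto_mult)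
  then show ?thesis unfolding calc_def by (intro exI[of _ "\<lambda>n. p n * q n"] conjI)
qed

lemma calc_star:
  assumes A: "star A = A" and "calc A g B"
  shows "calc A (\<lambda>z. cnj (g z)) (star B)"
proof -
  obtain p where p: "uniform_limit (spectrum (app A)) (\<lambda>n z. poly (p n) z) g sequentially"
    "(\<lambda>n. bpoly (p n) A) \<longlonglongrightarrow> B"
    using assms by (auto simp: calc_def)
  have cnj_poly: "poly (map_poly cnj (p n)) z = cnj (poly (p n) z)" if "z \<in> spectrum (app A)" for n z
    using poly_cnj[of "p n" z] spectrum_selfadjoint_real[OF A that] complex_eq_iff[of "cnj z" z] by simp
  have "uniform_limit (spectrum (app A)) (\<lambda>n z. cnj (poly (p n) z)) (\<lambda>z. cnj (g z)) sequentially"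
    using p(1) by (simp add: uniform_limit_iff dist_norm flip: complex_cnj_diff)
  then have "uniform_limit (spectrum (app A)) (\<lambda>n z. poly (map_poly cnj (p n)) z) (\<lambda>z. cnj (g z)) sequentially"
    using cnj_poly by (subst uniform_limit_cong') auto
  moreover have "(\<lambda>n. bpoly (map_poly cnj (p n)) A) \<longlonglongrightarrow> star B"
    using bounded_linear.tendsto[OF bounded_linear_star p(2)] by (simp add: star_bpoly A)
  ultimately show ?thesis
    unfolding calc_def by (intro exI[of _ "\<lambda>n. map_poly cnj (p n)"] conjI)
qed

lemma calc_norm_le:
  assumes A: "star A = A" and "calc A g B"
    and M: "0 \<le> M" "\<And>z. z \<in> spectrum (app A) \<Longrightarrow> cmod (g z) \<le> M"
  shows "norm B \<le> M"
proof (rule field_le_epsilon)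
  fix e :: real assume e: "e > 0"
  obtain p where p: "uniform_limit (spectrum (app A)) (\<lambda>n z. poly (p n) z) g sequentially"
    "(\<lambda>n. bpoly (p n) A) \<longlonglongrightarrow> B"
    using assms by (auto simp: calc_def)
  have "\<forall>\<^sub>F n in sequentially. norm (bpoly (p n) A) \<le> M + e"
    using uniform_limitD[OF p(1) e]
  proof eventually_elim
    case (elim n)
    have "cmod (poly (p n) z) \<le> M + e" if "z \<in> spectrum (app A)" for z
      using elim that M(2)[OF that] norm_triangle_ineq2[of "poly (p n) z" "g z"]
      by (force simp: dist_norm)
    then show ?case by (intro norm_bpoly_le[OF A]) (use M e in auto)
  qed
  then show "norm B \<le> M + e"
    using tendsto_upperbound[OF tendsto_norm[OF p(2)]] by simp
qed

lemma calc_closed: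
  assumes "calc A g B" "closed S" "\<And>p. bpoly p A \<in> S"
  shows "B \<in> S"
proof -
  obtain p where "(\<lambda>n. bpoly (p n) A) \<longlonglongrightarrow> B"
    using assms(1) by (auto simp: calc_def)
  then show ?thesis
    by (rule closed_sequentially[OF assms(2), rotated]) (rule assms(3))
qed

lemma complex_poly_approximation:
  fixes h :: "real \<Rightarrow> complex"
  assumes "continuous_on {a..b} h" "e > 0"
  obtains p where "\<And>t. t \<in> {a..b} \<Longrightarrow> cmod (poly p (complex_of_real t) - h t) < e"
proof -
  have real: "\<exists>p. \<forall>t\<in>{a..b}. cmod (poly p (complex_of_real t) - complex_of_real (g t)) < e / 2"
    if g: "continuous_on {a..b} g" for g :: "real \<Rightarrow> real"
  proof -
    obtain f where "real_polynomial_function f" and f: "\<And>t. t \<in> {a..b} \<Longrightarrow> \<bar>g t - f t\<bar> < e / 2"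
      using Stone_Weierstrass_real_polynomial_function[OF compact_Icc g, of "e / 2"] assms(2) by auto
    then obtain c n where c: "f = (\<lambda>t. \<Sum>i\<le>n. c i * t ^ i)"
      by (auto simp: real_polynomial_function_iff_sum)
    define P where "P = (\<Sum>i\<le>n. monom (complex_of_real (c i)) i)"
    have "cmod (poly P (complex_of_real t) - complex_of_real (g t)) < e / 2" if "t \<in> {a..b}" for t
    proof -
      have "poly P (complex_of_real t) = complex_of_real (f t)"
        by (simp add: P_def c poly_sum poly_monom)
      then have "cmod (poly P (complex_of_real t) - complex_of_real (g t)) = \<bar>g t - f t\<bar>"
        by (metis abs_minus_commute norm_of_real of_real_diff)
      then show ?thesis using f[OF that] by simp
    qed
    then show ?thesis by blast
  qed
  obtain p where p: "\<And>t. t\<in>{a..b} \<Longrightarrow> cmod (poly p (complex_of_real t) - complex_of_real (Re (h t))) < e / 2"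
    using real[OF continuous_on_Re[OF assms(1)]] by blast
  obtain q where q: "\<And>t. t\<in>{a..b} \<Longrightarrow> cmod (poly q (complex_of_real t) - complex_of_real (Im (h t))) < e / 2"
    using real[OF continuous_on_Im[OF assms(1)]] by blast
  show ?thesis
  proof (rule that[of "p + smult \<i> q"])
    fix t assume t: "t \<in> {a..b}"
    have "poly (p + smult \<i> q) (complex_of_real t) - h t
        = (poly p (complex_of_real t) - complex_of_real (Re (h t)))
          + \<i> * (poly q (complex_of_real t) - complex_of_real (Im (h t)))"
      by (simp add: complex_eq_iff)
    also have "cmod \<dots> \<le> cmod (poly p (complex_of_real t) - complex_of_real (Re (h t)))
          + cmod (poly q (complex_of_real t) - complex_of_real (Im (h t)))"
      by (rule order_trans[OF norm_triangle_ineq]) (simp add: norm_mult)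
    finally show "cmod (poly (p + smult \<i> q) (complex_of_real t) - h t) < e"
      using p[OF t] q[OF t] by linarith
  qed
qed

lemma calc_exists_continuous:
  assumes A: "star A = A" and spec: "spectrum (app A) \<subseteq> complex_of_real ` {a..b}"
    and h: "continuous_on {a..b} h"
  obtains B where "calc A (\<lambda>z. h (Re z)) B"
proof -
  have "\<exists>p. \<forall>t\<in>{a..b}. cmod (poly p (complex_of_real t) - h t) < 1 / Suc n" for n
    by (rule complex_poly_approximation[OF h, of "1 / Suc n"]) (simp, blast)
  then obtain p where p: "\<And>n t. t \<in> {a..b} \<Longrightarrow> cmod (poly (p n) (complex_of_real t) - h t) < 1 / Suc n"
    by metis
  have "uniform_limit (spectrum (app A)) (\<lambda>n z. poly (p n) z) (\<lambda>z. h (Re z)) sequentially"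
  proof (rule uniform_limitI)
    fix e :: real assume "e > 0"
    then have "\<forall>\<^sub>F n in sequentially. 1 / Suc n < e"
      using order_tendstoD(2)[OF LIMSEQ_Suc[OF lim_1_over_n]] by blast
    then show "\<forall>\<^sub>F n in sequentially. \<forall>z\<in>spectrum (app A). dist (poly (p n) z) (h (Re z)) < e"
    proof eventually_elim
      case (elim n)
      then show ?case using p[of _ n] spec by (force simp: dist_norm)
    qed
  qed
  then show ?thesis using calc_exists[OF A] that by blast
qed

section \<open>Complex powers of strictly positive operators\<close>

definition strictly_positive :: "'h::complex_hilbert_space bop \<Rightarrow> bool" where
  "strictly_positive A \<longleftrightarrow> star A = A \<and> (\<exists>c>0. \<forall>x. c * (norm x)\<^sup>2 \<le> x \<bullet> app A x)"

text \<open>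
  \<open>A\<^sup>w\<close> for complex \<open>w\<close>: the function applied to \<open>A\<close> is \<open>t\<^sup>w = exp (w ln t)\<close>.
\<close>

definition cpow :: "'h::complex_hilbert_space bop \<Rightarrow> complex \<Rightarrow> 'h bop" where
  "cpow A w = (SOME B. calc A (\<lambda>z. exp (w * complex_of_real (ln (Re z)))) B)"

lemma strictly_positive_selfadjoint: "strictly_positive A \<Longrightarrow> star A = A"
  by (simp add: strictly_positive_def)

lemma strictly_positive_spectrum:
  assumes "strictly_positive A"
  obtains a b where "a > 0" "spectrum (app A) \<subseteq> complex_of_real ` {a..b}"
  using assms spectrum_selfadjoint_bounds unfolding strictly_positive_def by (metis subsetI)

lemma strictly_positive_log_bound:
  assumes "strictly_positive A"
  obtains L where "0 \<le> L" "\<And>z. z \<in> spectrum (app A) \<Longrightarrow> \<bar>ln (Re z)\<bar> \<le> L"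
proof -
  obtain a b where ab: "a > 0" "spectrum (app A) \<subseteq> complex_of_real ` {a..b}"
    using strictly_positive_spectrum[OF assms] by blast
  have "\<bar>ln (Re z)\<bar> \<le> \<bar>ln a\<bar> + \<bar>ln b\<bar>" if "z \<in> spectrum (app A)" for z
  proof -
    have "a \<le> Re z" "Re z \<le> b" using that ab(2) by auto
    then have "ln a \<le> ln (Re z)" "ln (Re z) \<le> ln b" using ab(1) by auto
    then show ?thesis by linarith
  qed
  then show ?thesis using that[of "\<bar>ln a\<bar> + \<bar>ln b\<bar>"] by simp
qed

lemma calc_log_function:
  assumes A: "strictly_positive A" and f: "continuous_on UNIV f"
  obtains B where "calc A (\<lambda>z. f (ln (Re z))) B"
proof -
  obtain a b where ab: "a > 0" "spectrum (app A) \<subseteq> complex_of_real ` {a..b}"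
    using strictly_positive_spectrum[OF A] by blast
  have "continuous_on {a..b} (\<lambda>t. f (ln t))"
    by (rule continuous_on_compose2[OF f]) (use ab in \<open>auto intro!: continuous_intros\<close>)
  then show ?thesis
    using calc_exists_continuous[OF strictly_positive_selfadjoint[OF A] ab(2)] that by blast
qed

lemma calc_cpow:
  assumes "strictly_positive A"
  shows "calc A (\<lambda>z. exp (w * complex_of_real (ln (Re z)))) (cpow A w)"
proof -
  have "continuous_on UNIV (\<lambda>t. exp (w * complex_of_real t))"
    by (intro continuous_intros)
  then obtain B where "calc A (\<lambda>z. exp (w * complex_of_real (ln (Re z)))) B"
    by (rule calc_log_function[OF assms])
  then show ?thesis
    unfolding cpow_def by (rule someI)
qed

lemma cpow_unique:
  assumes "strictly_positive A"
    and "calc A g B" "\<And>z. z \<in> spectrum (app A) \<Longrightarrow> g z = exp (w * complex_of_real (ln (Re z)))"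
  shows "cpow A w = B"
  using calc_unique[OF strictly_positive_selfadjoint[OF assms(1)] calc_cpow[OF assms(1)]
      calc_cong[OF assms(2,3)]] by blast

lemma bounded_exp_log:
  assumes "strictly_positive A"
  shows "bounded ((\<lambda>z. exp (w * complex_of_real (ln (Re z)))) ` spectrum (app A))"
proof -
  obtain L where L: "0 \<le> L" "\<And>z. z \<in> spectrum (app A) \<Longrightarrow> \<bar>ln (Re z)\<bar> \<le> L"
    using strictly_positive_log_bound[OF assms] by blast
  have "cmod (exp (w * complex_of_real (ln (Re z)))) \<le> exp (cmod w * L)" if "z \<in> spectrum (app A)" for z
  proof -
    have "cmod (w * complex_of_real (ln (Re z))) \<le> cmod w * L"
      using L(2)[OF that] by (simp add: norm_mult mult_left_mono)
    then show ?thesis using norm_exp order_trans exp_le_cancel_iff by metis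
  qed
  then show ?thesis by (auto simp: bounded_iff)
qed

lemma cpow_add:
  assumes A: "strictly_positive A"
  shows "cpow A (w + v) = cpow A w * cpow A v"
  by (rule cpow_unique[OF A calc_mult[OF calc_cpow calc_cpow bounded_exp_log bounded_exp_log]])
    (simp_all add: A distrib_right exp_add)

lemma cpow_0 [simp]:
  assumes A: "strictly_positive A"
  shows "cpow A 0 = 1"
  using cpow_unique[OF A calc_poly[of A 1], of 0] by (simp add: one_pCons)

lemma cpow_1 [simp]:
  assumes A: "strictly_positive A"
  shows "cpow A 1 = A"
proof -
  obtain a b where ab: "a > 0" "spectrum (app A) \<subseteq> complex_of_real ` {a..b}"
    using strictly_positive_spectrum[OF A] by blast
  have "cpow A 1 = bpoly [:0, 1:] A"
    by (rule cpow_unique[OF A calc_poly]) (use ab in \<open>auto simp: exp_of_real\<close>)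
  then show ?thesis by simp
qed

lemma cpow_inverse:
  assumes A: "strictly_positive A"
  shows "cpow A w * cpow A (- w) = 1" "cpow A (- w) * cpow A w = 1"
  using cpow_add[OF A, of w "- w"] cpow_add[OF A, of "- w" w] cpow_0[OF A] by auto

lemma star_cpow:
  assumes A: "strictly_positive A"
  shows "star (cpow A w) = cpow A (cnj w)"
  by (rule cpow_unique[symmetric, OF A calc_star[OF strictly_positive_selfadjoint[OF A] calc_cpow[OF A]]])
    (simp add: exp_cnj)

lemma cpow_in_closed:
  assumes A: "strictly_positive A" and "closed S" "\<And>p. bpoly p A \<in> S"
  shows "cpow A w \<in> S"
  using calc_closed[OF calc_cpow[OF A]] assms by blast

lemma op_powr_eq_cpow:
  assumes A: "strictly_positive A"
  shows "op_powr (app A) s = app (cpow A (complex_of_real s))"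
  unfolding op_powr_def
proof (rule cont_fun_calc_eq[OF strictly_positive_selfadjoint[OF A]], rule calc_cong[OF calc_cpow[OF A]])
  obtain a b where ab: "a > 0" "spectrum (app A) \<subseteq> complex_of_real ` {a..b}"
    using strictly_positive_spectrum[OF A] by blast
  fix z assume "z \<in> spectrum (app A)"
  then have "Re z > 0" using ab by auto
  then show "exp (complex_of_real s * complex_of_real (ln (Re z))) = complex_of_real (Re z powr s)"
    by (simp add: powr_def flip: exp_of_real)
qed

lemma strictly_positive_star_mult:
  assumes "bop_unit S"
  shows "strictly_positive (star S * S)"
proof -
  obtain c where c: "c > 0" "\<And>x. c * norm x \<le> norm (app S x)"
    using bop_unit_bounded_below[OF assms] by blast
  have "c\<^sup>2 * (norm x)\<^sup>2 \<le> x \<bullet> app (star S * S) x" for x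
    using power_mono[OF c(2)[of x], of 2] c(1) by (simp add: power_mult_distrib norm_sq_star)
  then show ?thesis
    using c(1) unfolding strictly_positive_def by (intro conjI exI[of _ "c\<^sup>2"]) (auto simp: star_mult)
qed

lemma strictly_positive_cpow:
  assumes A: "strictly_positive A"
  shows "strictly_positive (cpow A (complex_of_real s))"
proof -
  define G where "G = cpow A (complex_of_real (s / 2))"
  have "bop_unit G"
    unfolding bop_unit_def G_def using cpow_inverse[OF A] by blast
  moreover have "star G * G = cpow A (complex_of_real s)"
    by (simp add: G_def star_cpow[OF A] flip: cpow_add[OF A] of_real_add)
  ultimately show ?thesis
    using strictly_positive_star_mult[of G] by simp
qed

text \<open>
  Here \<open>K\<close> is the logarithm of \<open>A\<close>. The functional calculus transfers the Taylor estimate of the scalar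
  functions \<open>t\<^sup>w\<close>, which is uniform because \<open>ln\<close> is bounded on the spectrum.
\<close>

lemma cpow_Taylor:
  assumes A: "strictly_positive A"
  shows "\<exists>K C. 0 \<le> C \<and> (\<forall>w. cmod w \<le> 1 \<longrightarrow>
    norm (cpow A w - (1 + scalar w * K + scalar (w\<^sup>2 / 2) * (K * K))) \<le> C * cmod w ^ 3)"
proof -
  obtain L where L: "0 \<le> L" "\<And>z. z \<in> spectrum (app A) \<Longrightarrow> \<bar>ln (Re z)\<bar> \<le> L"
    using strictly_positive_log_bound[OF A] by blast
  define g where "g z = complex_of_real (ln (Re z))" for z
  have "continuous_on UNIV complex_of_real" by (intro continuous_intros)
  then obtain K where K: "calc A g K"
    unfolding g_def by (rule calc_log_function[OF A])
  have "bounded (g ` spectrum (app A))"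
    using L by (auto simp: bounded_iff g_def)
  then have K2: "calc A (\<lambda>z. g z * g z) (K * K)"
    using calc_mult[OF K K] by blast
  define C where "C = exp L * L ^ 3 / 2"
  have "norm (cpow A w - (1 + scalar w * K + scalar (w\<^sup>2 / 2) * (K * K))) \<le> C * cmod w ^ 3"
    if w: "cmod w \<le> 1" for w
  proof (rule calc_norm_le[OF strictly_positive_selfadjoint[OF A]])
    have "calc A (\<lambda>z. poly 1 z + w * g z + w\<^sup>2 / 2 * (g z * g z))
        (bpoly 1 A + scalar w * K + scalar (w\<^sup>2 / 2) * (K * K))"
      by (intro calc_linear calc_poly K K2)
    from calc_linear[OF calc_cpow[OF A, of w] this, of "-1"]
    show "calc A (\<lambda>z. exp (w * g z) - (1 + w * g z + w\<^sup>2 / 2 * (g z * g z)))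
        (cpow A w - (1 + scalar w * K + scalar (w\<^sup>2 / 2) * (K * K)))"
      by (simp add: scalar_minus one_pCons g_def algebra_simps)
    show "0 \<le> C * cmod w ^ 3" using L by (simp add: C_def)
    fix z assume z: "z \<in> spectrum (app A)"
    have gz: "cmod (w * g z) \<le> cmod w * L"
      using L(2)[OF z] by (simp add: g_def norm_mult mult_left_mono)
    have sum_eq: "(\<Sum>k\<le>2. (w * g z) ^ k / fact k) = 1 + w * g z + w\<^sup>2 / 2 * (g z * g z)"
      by (simp add: numeral_2_eq_2 power2_eq_square mult_ac)
    have "cmod (exp (w * g z) - (1 + w * g z + w\<^sup>2 / 2 * (g z * g z)))
        \<le> exp \<bar>Re (w * g z)\<bar> * cmod (w * g z) ^ 3 / 2"
      using Taylor_exp[of "w * g z" 2, unfolded sum_eq] by simp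
    also have "\<dots> \<le> exp L * (cmod w * L) ^ 3 / 2"
    proof (intro divide_right_mono mult_mono power_mono gz)
      have "\<bar>Re (w * g z)\<bar> \<le> cmod w * L"
        using abs_Re_le_cmod gz by (rule order_trans)
      also have "\<dots> \<le> L" using w L by (simp add: mult_left_le_one_le)
      finally show "exp \<bar>Re (w * g z)\<bar> \<le> exp L" by simp
    qed auto
    finally show "cmod (exp (w * g z) - (1 + w * g z + w\<^sup>2 / 2 * (g z * g z))) \<le> C * cmod w ^ 3"
      by (simp add: C_def power_mult_distrib mult_ac)
  qed
  moreover have "0 \<le> C" using L by (simp add: C_def)
  ultimately show ?thesis by blast
qed

lemma continuous_cpow:
  assumes A: "strictly_positive A"
  shows "continuous_on S (\<lambda>x. cpow A (complex_of_real x))"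
proof -
  obtain K C where KC: "0 \<le> C" "\<forall>w. cmod w \<le> 1 \<longrightarrow>
    norm (cpow A w - (1 + scalar w * K + scalar (w\<^sup>2 / 2) * (K * K))) \<le> C * cmod w ^ 3"
    using cpow_Taylor[OF A] by blast
  have bound: "norm (cpow A (complex_of_real h) - (1 + h *\<^sub>R K + (h\<^sup>2 / 2) *\<^sub>R (K * K))) \<le> C * \<bar>h\<bar> ^ 3"
    if "\<bar>h\<bar> \<le> 1" for h
  proof -
    have "scalar ((complex_of_real h)\<^sup>2 / 2) = (h\<^sup>2 / 2) *\<^sub>R (1 :: 'a bop)"
      using scalar_of_real[of "h\<^sup>2 / 2"] by simp
    then show ?thesis
      using KC(2)[rule_format, of "complex_of_real h"] that by (simp add: scalar_of_real)
  qed
  have "((\<lambda>h. cpow A (complex_of_real h) - (1 + h *\<^sub>R K + (h\<^sup>2 / 2) *\<^sub>R (K * K))) \<longlongrightarrow> 0) (at 0)"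
  proof (rule Lim_null_comparison)
    show "\<forall>\<^sub>F h in at 0. norm (cpow A (complex_of_real h)
        - (1 + h *\<^sub>R K + (h\<^sup>2 / 2) *\<^sub>R (K * K))) \<le> C * \<bar>h\<bar> ^ 3"
      unfolding eventually_at using bound by (intro exI[of _ 1]) simp
    show "((\<lambda>h. C * \<bar>h\<bar> ^ 3) \<longlongrightarrow> 0) (at 0)"
      by (rule tendsto_eq_intros refl | simp)+
  qed
  moreover have "((\<lambda>h. 1 + h *\<^sub>R K + (h\<^sup>2 / 2) *\<^sub>R (K * K)) \<longlongrightarrow> 1 + 0 *\<^sub>R K + (0\<^sup>2 / 2) *\<^sub>R (K * K)) (at 0)"
    by (intro tendsto_intros) simp
  ultimately have "((\<lambda>h. cpow A (complex_of_real h)) \<longlongrightarrow> 1) (at 0)"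
    using tendsto_add by fastforce
  then have "((\<lambda>h. cpow A (complex_of_real x) * cpow A (complex_of_real h))
      \<longlongrightarrow> cpow A (complex_of_real x) * 1) (at 0)" for x
    by (intro tendsto_intros)
  then have "isCont (\<lambda>x. cpow A (complex_of_real x)) x" for x
    by (simp add: isCont_iff cpow_add[OF A])
  then show ?thesis
    by (simp add: continuous_at_imp_continuous_on)
qed

section \<open>Convexity along a one-parameter family of conjugates\<close>

text \<open>
  A one-dimensional maximum principle: a function whose second differences are nonnegative up to \<open>O(r\<^sup>3)\<close> is
  convex. If \<open>g\<close> is positive somewhere, adding a small multiple of \<open>t\<^sup>2 - t\<close>, which vanishes at both ends, leaves
  an interior maximum. There the second difference of the sum is nonpositive, so that of \<open>g\<close> is below a negative
  multiple of \<open>r\<^sup>2\<close>, which \<open>O(r\<^sup>3)\<close> cannot compensate.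
\<close>

lemma nonpos_if_second_differences_nonneg:
  fixes g :: "real \<Rightarrow> real"
  assumes cont: "continuous_on {0..1} g" and ends: "g 0 \<le> 0" "g 1 \<le> 0"
    and second: "\<And>x. \<exists>C. \<forall>r. 0 < r \<and> r \<le> 1 \<longrightarrow> 2 * g x \<le> g (x + r) + g (x - r) + C * r ^ 3"
    and x: "x \<in> {0..1}"
  shows "g x \<le> 0"
proof (rule ccontr)
  assume "\<not> g x \<le> 0"
  define e where "e = g x"
  define h where "h t = g t + e * (t\<^sup>2 - t)" for t
  have e: "e > 0" using \<open>\<not> g x \<le> 0\<close> by (simp add: e_def)
  have "continuous_on {0..1} h"
    unfolding h_def by (intro continuous_intros cont)
  then obtain y where y: "y \<in> {0..1}" "\<And>t. t \<in> {0..1} \<Longrightarrow> h t \<le> h y"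
    using continuous_attains_sup[of "{0..1::real}" h] by auto
  have "x - x\<^sup>2 \<le> 1 / 4"
    using zero_le_power2[of "x - 1 / 2"] by (simp add: power2_eq_square algebra_simps)
  then have "e * (x - x\<^sup>2) \<le> e * (1 / 4)"
    using e by (intro mult_left_mono) auto
  then have "h x > 0"
    using e by (simp add: h_def e_def[symmetric] algebra_simps)
  then have "h y > 0"
    using y(2)[OF x] by simp
  then have "y \<noteq> 0" "y \<noteq> 1"
    using ends by (auto simp: h_def)
  then have y01: "0 < y" "y < 1" using y(1) by auto
  obtain C where C: "\<And>r. 0 < r \<Longrightarrow> r \<le> 1 \<Longrightarrow> 2 * g y \<le> g (y + r) + g (y - r) + C * r ^ 3"
    using second[of y] by blast
  define r where "r = min (min y (1 - y)) (e / (\<bar>C\<bar> + 1))"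
  have r: "0 < r" "r \<le> y" "r \<le> 1 - y" "r \<le> 1" "r \<le> e / (\<bar>C\<bar> + 1)"
    using y01 e by (auto simp: r_def)
  have "h (y + r) + h (y - r) \<le> 2 * h y"
    using y(2)[of "y + r"] y(2)[of "y - r"] r y01 by auto
  then have "g (y + r) + g (y - r) + 2 * e * r\<^sup>2 \<le> 2 * g y"
    by (simp add: h_def power2_eq_square algebra_simps)
  then have "2 * e * r\<^sup>2 \<le> C * r ^ 3"
    using C[of r] r by linarith
  then have "r\<^sup>2 * (2 * e) \<le> r\<^sup>2 * (C * r)"
    by (simp add: power2_eq_square power3_eq_cube mult_ac)
  then have "2 * e \<le> C * r"
    using r(1) by simp
  also have "\<dots> \<le> (\<bar>C\<bar> + 1) * r"
    using r(1) by (intro mult_right_mono) auto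
  also have "\<dots> \<le> e"
    using r(5) by (simp add: pos_le_divide_eq mult.commute)
  finally show False using e by simp
qed

lemma infdist_midpoint_le:
  fixes C :: "'a::real_normed_vector set"
  assumes C: "convex C" "C \<noteq> {}"
  shows "infdist ((1/2) *\<^sub>R (a + b)) C \<le> (infdist a C + infdist b C) / 2"
proof (rule field_le_epsilon)
  have near: "\<exists>y\<in>C. dist x y < infdist x C + e" if "e > 0" for x and e :: real
  proof -
    have "(INF y\<in>C. dist x y) < infdist x C + e"
      using that C by (simp add: infdist_notempty)
    then show ?thesis
      using cInf_lessD[of "dist x ` C"] C by auto
  qed
  fix e :: real assume e: "e > 0"
  obtain y z where y: "y \<in> C" "dist a y < infdist a C + e" and z: "z \<in> C" "dist b z < infdist b C + e"
    using near[OF e] by metis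
  have "(1/2) *\<^sub>R y + (1/2) *\<^sub>R z \<in> C"
    by (rule convexD[OF C(1) y(1) z(1)]) auto
  then have "infdist ((1/2) *\<^sub>R (a + b)) C \<le> dist ((1/2) *\<^sub>R (a + b)) ((1/2) *\<^sub>R y + (1/2) *\<^sub>R z)"
    by (rule infdist_le)
  also have "\<dots> = norm ((1/2) *\<^sub>R ((a - y) + (b - z)))"
    by (simp add: dist_norm algebra_simps)
  also have "\<dots> \<le> (dist a y + dist b z) / 2"
    using norm_triangle_ineq[of "a - y" "b - z"] by (simp add: dist_norm)
  also have "\<dots> \<le> (infdist a C + infdist b C) / 2 + e"
    using y(2) z(2) by argo
  finally show "infdist ((1/2) *\<^sub>R (a + b)) C \<le> (infdist a C + infdist b C) / 2 + e" .
qed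

lemma infdist_conjugate_le:
  fixes V W :: "'h::complex_hilbert_space bop"
  assumes "C \<noteq> {}" and norms: "norm V \<le> 1" "norm W \<le> 1"
    and inv: "\<And>Y. Y \<in> C \<Longrightarrow> V * Y * W \<in> C"
  shows "infdist (V * X * W) C \<le> infdist X C"
proof -
  have "infdist (V * X * W) C \<le> dist X Y" if "Y \<in> C" for Y
  proof -
    have "infdist (V * X * W) C \<le> norm (V * X * W - V * Y * W)"
      using infdist_le[OF inv[OF that]] by (simp add: dist_norm)
    also have "V * X * W - V * Y * W = V * (X - Y) * W"
      by (simp add: algebra_simps)
    also have "norm \<dots> \<le> norm V * norm (X - Y) * norm W"
      by (rule order_trans[OF norm_mult_ineq]) (simp add: mult_right_mono norm_mult_ineq)
    also have "\<dots> \<le> 1 * norm (X - Y) * 1"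
      using norms by (intro mult_mono) auto
    finally show ?thesis by (simp add: dist_norm)
  qed
  then show ?thesis
    using assms(1) by (simp add: infdist_notempty[of C X] cINF_greatest)
qed

text \<open>
  \<open>1 + S + S\<^sup>2 / 2\<close> and \<open>1 - S + S\<^sup>2 / 2\<close> are the Taylor polynomials of the exponentials of \<open>S\<close> and \<open>-S\<close>, and \<open>T2\<close> is half of the double
  commutator of \<open>S\<close> with \<open>B\<close>.
\<close>

lemma conjugate_by_quadratic:
  fixes S B :: "'h::complex_hilbert_space bop"
  defines "T2 \<equiv> (1/2) *\<^sub>R (S * S * B) - S * B * S + (1/2) *\<^sub>R (B * S * S)"
  shows "norm ((1 + S + (1/2) *\<^sub>R (S * S)) * B * (1 - S + (1/2) *\<^sub>R (S * S)) - (B + (S * B - B * S) + T2))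
    \<le> norm B * norm S ^ 3 + norm B * norm S ^ 4"
proof -
  have "(1 + S + (1/2) *\<^sub>R (S * S)) * B * (1 - S + (1/2) *\<^sub>R (S * S)) - (B + (S * B - B * S) + T2)
    = (1/2) *\<^sub>R (S * B * S * S) - (1/2) *\<^sub>R (S * S * B * S) + (1/4) *\<^sub>R (S * S * B * S * S)"
    unfolding T2_def by (simp add: algebra_simps)
  also have "norm \<dots> \<le> norm (S * B * S * S) / 2 + norm (S * S * B * S) / 2 + norm (S * S * B * S * S) / 4"
    by (rule order_trans[OF norm_triangle_ineq] add_mono order_trans[OF norm_triangle_ineq4])+ simp_all
  also have "\<dots> \<le> (norm S * norm B * norm S * norm S) / 2 + (norm S * norm S * norm B * norm S) / 2
      + (norm S * norm S * norm B * norm S * norm S) / 4"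
    by (intro add_mono divide_right_mono order_trans[OF norm_mult_ineq] mult_right_mono) auto
  also have "\<dots> \<le> norm B * norm S ^ 3 + norm B * norm S ^ 4"
    by (simp add: power3_eq_cube power4_eq_xxxx mult_ac)
  finally show ?thesis .
qed

text \<open>
  Replacing \<open>A\<^sup>w\<close> and \<open>A\<^sup>-\<^sup>w\<close> by their quadratic Taylor polynomials \<open>P\<close> and \<open>Q\<close> costs \<open>O(\<bar>w\<bar>\<^sup>3)\<close>, and so does
  cutting off \<open>P B Q\<close> after the second order.
\<close>

lemma conjugate_cpow_expansion:
  fixes A B :: "'h::complex_hilbert_space bop"
  assumes A: "strictly_positive A"
  shows "\<exists>X Y C. \<forall>w. cmod w \<le> 1 \<longrightarrow>
    norm (cpow A w * B * cpow A (- w) - (B + scalar w * X + scalar (w\<^sup>2) * Y)) \<le> C * cmod w ^ 3"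
proof -
  obtain K c where c: "0 \<le> c" and Taylor: "\<And>w. cmod w \<le> 1 \<Longrightarrow>
    norm (cpow A w - (1 + scalar w * K + scalar (w\<^sup>2 / 2) * (K * K))) \<le> c * cmod w ^ 3"
    using cpow_Taylor[OF A] by metis
  define k p where "k = norm K" and "p = 1 + k + k * k"
  define X where "X = K * B - B * K"
  define Y where "Y = (1/2) *\<^sub>R (K * K * B) - K * B * K + (1/2) *\<^sub>R (B * K * K)"
  define C where "C = c * norm B * (p + c) + p * norm B * c + norm B * k ^ 3 + norm B * k ^ 4"
  have k: "k \<ge> 0" by (simp add: k_def)
  have "norm (cpow A w * B * cpow A (- w) - (B + scalar w * X + scalar (w\<^sup>2) * Y)) \<le> C * cmod w ^ 3"
    if w: "cmod w \<le> 1" for w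
  proof -
    define S where "S = scalar w * K"
    define P Q R R' where "P = 1 + S + (1/2) *\<^sub>R (S * S)" and "Q = 1 - S + (1/2) *\<^sub>R (S * S)"
      and "R = cpow A w - P" and "R' = cpow A (- w) - Q"
    have K_scalar: "K * (scalar v * Z) = scalar v * (K * Z)" "B * (scalar v * Z) = scalar v * (B * Z)" for v Z
      by (metis mult.assoc scalar_commute)+
    have half: "scalar (w\<^sup>2 / 2) * (K * K) = (1/2) *\<^sub>R (S * S)"
    proof -
      have "scalar (w\<^sup>2 / 2) = (1/2) *\<^sub>R (scalar w * scalar w :: 'h bop)"
        using scalar_mult[of "1/2" "w * w", where 'a = 'h] scalar_of_real[of "1/2", where 'a = 'h]
        by (simp add: scalar_mult power2_eq_square)
      then show ?thesis by (simp add: S_def K_scalar mult.assoc)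
    qed
    have R: "norm R \<le> c * cmod w ^ 3" and R': "norm R' \<le> c * cmod w ^ 3"
      using Taylor[of w] Taylor[of "- w"] w half
      by (simp_all add: R_def R'_def P_def Q_def S_def scalar_minus)
    have S: "norm S \<le> cmod w * k"
      unfolding S_def k_def by (rule norm_scalar_mult_le)
    have S1: "norm S \<le> k"
      using S w k by (meson mult_left_le_one_le norm_ge_zero order_trans)
    have one: "norm (1 :: 'h bop) \<le> 1"
      by (rule norm_bop_bound) auto
    have SS: "norm (S * S) \<le> k * k"
      by (rule order_trans[OF norm_mult_ineq]) (intro mult_mono S1, use k in auto)
    then have SS2: "norm ((1/2) *\<^sub>R (S * S)) \<le> k * k"
      using norm_ge_zero[of "S * S"] unfolding norm_scaleR by linarith
    have PQ: "norm P \<le> p" "norm Q \<le> p"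
      using norm_triangle_ineq[of "1 + S" "(1/2) *\<^sub>R (S * S)"] norm_triangle_ineq[of 1 S]
        norm_triangle_ineq[of "1 - S" "(1/2) *\<^sub>R (S * S)"] norm_triangle_ineq4[of 1 S] one S1 SS2
      unfolding P_def Q_def p_def by linarith+
    have w3: "cmod w ^ 3 \<le> 1" "cmod w ^ 4 \<le> cmod w ^ 3"
      using w by (auto intro: power_le_one power_decreasing)
    have "norm (cpow A (- w)) \<le> p + c"
    proof -
      have "norm (cpow A (- w)) \<le> norm R' + norm Q"
        using norm_triangle_ineq[of R' Q] by (simp add: R'_def)
      moreover have "c * cmod w ^ 3 \<le> c" using c w3 by (simp add: mult_left_le)
      ultimately show ?thesis using R' PQ by linarith
    qed
    then have 1: "norm (R * B * cpow A (- w)) \<le> c * cmod w ^ 3 * norm B * (p + c)"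
      by (intro order_trans[OF norm_mult_ineq] mult_mono R) (use c in auto)
    have 2: "norm (P * B * R') \<le> p * norm B * (c * cmod w ^ 3)"
      by (intro order_trans[OF norm_mult_ineq] mult_mono R' PQ) (use c k in \<open>auto simp: p_def\<close>)
    have "norm (P * B * Q - (B + (S * B - B * S)
        + ((1/2) *\<^sub>R (S * S * B) - S * B * S + (1/2) *\<^sub>R (B * S * S)))) \<le> norm B * norm S ^ 3 + norm B * norm S ^ 4"
      unfolding P_def Q_def by (rule conjugate_by_quadratic)
    also have "B + (S * B - B * S) + ((1/2) *\<^sub>R (S * S * B) - S * B * S + (1/2) *\<^sub>R (B * S * S))
      = B + scalar w * X + scalar (w\<^sup>2) * Y"
      by (simp add: S_def X_def Y_def K_scalar mult.assoc power2_eq_square scalar_mult distrib_left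
          right_diff_distrib)
    also have "norm B * norm S ^ 3 + norm B * norm S ^ 4 \<le> norm B * k ^ 3 * cmod w ^ 3 + norm B * k ^ 4 * cmod w ^ 3"
    proof -
      have "norm S ^ 3 \<le> k ^ 3 * cmod w ^ 3" "norm S ^ 4 \<le> k ^ 4 * cmod w ^ 4"
        using power_mono[OF S, of 3] power_mono[OF S, of 4] by (simp_all add: power_mult_distrib mult.commute)
      moreover have "k ^ 4 * cmod w ^ 4 \<le> k ^ 4 * cmod w ^ 3"
        using w3 by (intro mult_left_mono) auto
      ultimately show ?thesis
        by (simp add: mult.assoc add_mono mult_left_mono)
    qed
    finally have 3: "norm (P * B * Q - (B + scalar w * X + scalar (w\<^sup>2) * Y))
        \<le> norm B * k ^ 3 * cmod w ^ 3 + norm B * k ^ 4 * cmod w ^ 3" .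
    have "cpow A w * B * cpow A (- w) - (B + scalar w * X + scalar (w\<^sup>2) * Y)
        = R * B * cpow A (- w) + P * B * R' + (P * B * Q - (B + scalar w * X + scalar (w\<^sup>2) * Y))"
      by (simp add: R_def R'_def left_diff_distrib right_diff_distrib)
    also have "norm \<dots> \<le> norm (R * B * cpow A (- w)) + norm (P * B * R')
        + norm (P * B * Q - (B + scalar w * X + scalar (w\<^sup>2) * Y))"
      by (meson norm_triangle_le add_mono order_refl norm_triangle_ineq)
    also have "\<dots> \<le> c * cmod w ^ 3 * norm B * (p + c) + p * norm B * (c * cmod w ^ 3)
        + (norm B * k ^ 3 * cmod w ^ 3 + norm B * k ^ 4 * cmod w ^ 3)"
      by (intro add_mono 1 2 3)
    also have "\<dots> = C * cmod w ^ 3"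
      by (simp add: C_def algebra_simps)
    finally show ?thesis .
  qed
  then show ?thesis by blast
qed

text \<open>
  The mean value property of the holomorphic function \<open>w \<mapsto> A\<^sup>w B A\<^sup>-\<^sup>w\<close> at the corners \<open>r, -r, \<i> r, -\<i> r\<close> of a
  square: the terms of first and second order in \<open>w\<close> add up to zero. The average is nested because convexity is
  used below for midpoints.
\<close>

lemma conjugate_cpow_four_point:
  fixes A B :: "'h::complex_hilbert_space bop"
  assumes A: "strictly_positive A"
  defines "D \<equiv> \<lambda>w. cpow A w * B * cpow A (- w)"
  shows "\<exists>C. \<forall>r. 0 < r \<and> r \<le> 1 \<longrightarrow>
    norm (B - (1/2) *\<^sub>R ((1/2) *\<^sub>R (D (complex_of_real r) + D (- complex_of_real r))
      + (1/2) *\<^sub>R (D (\<i> * complex_of_real r) + D (- (\<i> * complex_of_real r))))) \<le> C * r ^ 3"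
proof -
  obtain X Y C where C: "\<And>w. cmod w \<le> 1 \<Longrightarrow>
    norm (D w - (B + scalar w * X + scalar (w\<^sup>2) * Y)) \<le> C * cmod w ^ 3"
    using conjugate_cpow_expansion[OF A, of B] unfolding D_def by metis
  have "norm (B - (1/2) *\<^sub>R ((1/2) *\<^sub>R (D (complex_of_real r) + D (- complex_of_real r))
      + (1/2) *\<^sub>R (D (\<i> * complex_of_real r) + D (- (\<i> * complex_of_real r))))) \<le> C * r ^ 3"
    if r: "0 < r" "r \<le> 1" for r
  proof -
    define E where "E w = D w - (B + scalar w * X + scalar (w\<^sup>2) * Y)" for w
    define a b where "a = complex_of_real r" and "b = \<i> * complex_of_real r"
    have cm: "cmod a = r" "cmod (- a) = r" "cmod b = r" "cmod (- b) = r"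
      using r by (auto simp: a_def b_def norm_mult)
    have b2: "b\<^sup>2 = - a\<^sup>2" by (simp add: a_def b_def power_mult_distrib)
    have E: "norm (E a) \<le> C * r ^ 3" "norm (E (- a)) \<le> C * r ^ 3"
      "norm (E b) \<le> C * r ^ 3" "norm (E (- b)) \<le> C * r ^ 3"
      unfolding E_def using C[of a] C[of "- a"] C[of b] C[of "- b"] cm r by simp_all
    have D: "D w = E w + (B + scalar w * X + scalar (w\<^sup>2) * Y)" for w
      by (simp add: E_def)
    have "(D a + D (- a)) + (D b + D (- b)) = (E a + E (- a) + E b + E (- b)) + 4 *\<^sub>R B"
      unfolding D by (simp add: b2 scalar_minus algebra_simps scaleR_left.add[of 2 2, simplified] scaleR_2)
    then have "B - (1/2) *\<^sub>R ((1/2) *\<^sub>R (D a + D (- a)) + (1/2) *\<^sub>R (D b + D (- b)))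
        = - ((1/4) *\<^sub>R (E a + E (- a) + E b + E (- b)))"
      by (simp flip: scaleR_add_right) (simp add: scaleR_add_right)
    also have "norm \<dots> \<le> (norm (E a) + norm (E (- a)) + norm (E b) + norm (E (- b))) / 4"
      using norm_triangle_ineq[of "E a" "E (- a)"] norm_triangle_ineq[of "E a + E (- a)" "E b"]
        norm_triangle_ineq[of "E a + E (- a) + E b" "E (- b)"] by simp
    also have "\<dots> \<le> C * r ^ 3"
      using add_mono[OF add_mono[OF E(1,2)] add_mono[OF E(3,4)]] by simp
    finally show ?thesis by (simp add: a_def b_def)
  qed
  then show ?thesis by blast
qed

lemma norm_cpow_imaginary:
  assumes A: "strictly_positive A"
  shows "norm (cpow A (\<i> * complex_of_real t)) \<le> 1"
  by (rule calc_norm_le[OF strictly_positive_selfadjoint[OF A] calc_cpow[OF A]]) simp_all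

text \<open>
  The core of the argument. Let \<open>F x = A\<^sup>x B A\<^sup>-\<^sup>x\<close> and let \<open>d x\<close> be the distance from \<open>F x\<close> to the convex set
  \<open>C\<close>. In the four-point formula for \<open>F x\<close> the two real corners are \<open>F (x + r)\<close> and \<open>F (x - r)\<close>, while the two
  imaginary corners are conjugates of \<open>F x\<close> by contractions preserving \<open>C\<close> and so are no farther from \<open>C\<close>
  than \<open>F x\<close>. Hence \<open>4 d x \<le> d (x + r) + d (x - r) + 2 d x + O(r\<^sup>3)\<close>, and \<open>d\<close> vanishes at both ends.
\<close>

lemma conjugate_cpow_in_closed_convex_hull:
  fixes A B :: "'h::complex_hilbert_space bop"
  assumes A: "strictly_positive A" and C: "convex C"
    and inv: "\<And>Y t. Y \<in> C \<Longrightarrow>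
      cpow A (\<i> * complex_of_real t) * Y * cpow A (- (\<i> * complex_of_real t)) \<in> C"
    and ends: "B \<in> C" "A * B * cpow A (- 1) \<in> C"
    and l: "0 \<le> l" "l \<le> 1"
  shows "cpow A (complex_of_real l) * B * cpow A (- complex_of_real l) \<in> closure C"
proof -
  have ne: "C \<noteq> {}" using ends by blast
  define F where "F x = cpow A (complex_of_real x) * B * cpow A (- complex_of_real x)" for x
  have F_add: "F (x + y) = cpow A (complex_of_real y) * F x * cpow A (- complex_of_real y)" for x y
    using cpow_add[OF A, of "complex_of_real y" "complex_of_real x"]
      cpow_add[OF A, of "- complex_of_real x" "- complex_of_real y"]
    by (simp add: F_def mult.assoc add.commute)
  have imag: "infdist (cpow A (\<i> * complex_of_real t) * X * cpow A (- (\<i> * complex_of_real t))) C \<le> infdist X C"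
    for t X
    using norm_cpow_imaginary[OF A, of t] norm_cpow_imaginary[OF A, of "- t"]
    by (intro infdist_conjugate_le ne inv) auto
  have "infdist (F l) C \<le> 0"
  proof (rule nonpos_if_second_differences_nonneg[of "\<lambda>x. infdist (F x) C" l])
    have "continuous_on {0..1} (\<lambda>x. cpow A (complex_of_real (- x)))"
      by (rule continuous_on_compose2[OF continuous_cpow[OF A, of UNIV]]) (auto intro!: continuous_intros)
    then have "continuous_on {0..1} F"
      unfolding F_def by (intro continuous_intros continuous_cpow[OF A]) simp
    then show "continuous_on {0..1} (\<lambda>x. infdist (F x) C)"
      by (rule continuous_on_infdist)
    show "infdist (F 0) C \<le> 0" "infdist (F 1) C \<le> 0"
      using ends by (simp_all add: F_def A)
    show "\<exists>c. \<forall>r. 0 < r \<and> r \<le> 1 \<longrightarrow>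
      2 * infdist (F x) C \<le> infdist (F (x + r)) C + infdist (F (x - r)) C + c * r ^ 3" for x
    proof -
      define D where "D w = cpow A w * F x * cpow A (- w)" for w
      obtain c where c: "\<And>r. 0 < r \<Longrightarrow> r \<le> 1 \<Longrightarrow>
        norm (F x - (1/2) *\<^sub>R ((1/2) *\<^sub>R (D (complex_of_real r) + D (- complex_of_real r))
          + (1/2) *\<^sub>R (D (\<i> * complex_of_real r) + D (- (\<i> * complex_of_real r))))) \<le> c * r ^ 3"
        using conjugate_cpow_four_point[OF A, of "F x"] unfolding D_def by metis
      have "2 * infdist (F x) C \<le> infdist (F (x + r)) C + infdist (F (x - r)) C + 4 * c * r ^ 3"
        if r: "0 < r" "r \<le> 1" for r
      proof -
        define Z1 where "Z1 = (1/2) *\<^sub>R (D (complex_of_real r) + D (- complex_of_real r))"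
        define Z2 where "Z2 = (1/2) *\<^sub>R (D (\<i> * complex_of_real r) + D (- (\<i> * complex_of_real r)))"
        have D: "D (complex_of_real r) = F (x + r)" "D (- complex_of_real r) = F (x - r)"
          using F_add[of x r] F_add[of x "- r"] by (simp_all add: D_def)
        have "infdist (F x) C \<le> infdist ((1/2) *\<^sub>R (Z1 + Z2)) C + c * r ^ 3"
          using infdist_triangle[of "F x" C "(1/2) *\<^sub>R (Z1 + Z2)"] c[OF r]
          by (simp add: dist_norm Z1_def Z2_def)
        moreover have "infdist ((1/2) *\<^sub>R (Z1 + Z2)) C \<le> (infdist Z1 C + infdist Z2 C) / 2"
          by (rule infdist_midpoint_le[OF C ne])
        moreover have "infdist Z1 C \<le> (infdist (F (x + r)) C + infdist (F (x - r)) C) / 2"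
          unfolding Z1_def D by (rule infdist_midpoint_le[OF C ne])
        moreover have "infdist Z2 C \<le> (infdist (D (\<i> * complex_of_real r)) C
            + infdist (D (- (\<i> * complex_of_real r))) C) / 2"
          unfolding Z2_def by (rule infdist_midpoint_le[OF C ne])
        moreover have "infdist (D (\<i> * complex_of_real r)) C \<le> infdist (F x) C"
          "infdist (D (- (\<i> * complex_of_real r))) C \<le> infdist (F x) C"
          using imag[of r "F x"] imag[of "- r" "F x"] by (simp_all add: D_def)
        ultimately show ?thesis by argo
      qed
      then show ?thesis by blast
    qed
  qed (use l in auto)
  then have "infdist (F l) C = 0"
    using infdist_nonneg[of "F l" C] by linarith
  then show ?thesis
    using in_closure_iff_infdist_zero[OF ne] by (simp add: F_def)
qed

section \<open>Aluthge transforms and unitary orbits\<close>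

lemma continuous_map_app: "continuous_map euclidean weak_op_topology app"
  unfolding weak_op_topology_def
proof (rule continuous_map_pullback')
  have bl: "bounded_linear (\<lambda>A. app A x)" for x :: 'a
    by (rule bounded_linear_intro[where K = "norm x"]) (auto simp: norm_app_le)
  have cinner_eq: "cinner u y = complex_of_real (u \<bullet> y) + \<i> * complex_of_real ((- \<i>) *\<^sub>C u \<bullet> y)"
    for u y :: 'a
    by (simp add: complex_eq_iff Re_cinner Im_cinner)
  have "continuous_on UNIV (\<lambda>A. cinner (app A x) y)" for x y :: 'a
    unfolding cinner_eq
    by (intro continuous_intros bounded_linear.continuous_on[OF bounded_linear_scaleC]
        bounded_linear.continuous_on[OF bl])
  then show "continuous_map euclidean (product_topology (\<lambda>_. euclidean) (UNIV :: ('a \<times> 'a) set))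
      ((\<lambda>A. \<lambda>(x, y)\<in>UNIV. cinner (A x) y) \<circ> app)"
    by (auto simp: continuous_map_componentwise_UNIV)
  show "topspace euclidean \<subseteq> app -` (bounded_ops :: ('a \<Rightarrow> 'a) set)"
    using app by (auto simp: bounded_ops_def)
qed

lemma app_closure_subset: "app ` closure C \<subseteq> weak_op_topology closure_of (app ` C)"
  using continuous_map_image_closure_subset[OF continuous_map_app, of C]
  by (simp only: euclidean_closure_of)

lemma closed_app_vimage:
  assumes "closedin weak_op_topology M"
  shows "closed {A. app A \<in> M}"
  using closedin_continuous_map_preimage[OF continuous_map_app assms] by simp

lemma app_unitaries_iff:
  "app V \<in> unitaries M \<longleftrightarrow> app V \<in> M \<and> star V * V = 1 \<and> V * star V = 1"
proof -
  have "adj (app V) \<circ> app V = app (star V * V)" "app V \<circ> adj (app V) = app (V * star V)"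
    by (auto simp: app_star)
  moreover have "app X = id \<longleftrightarrow> X = 1" for X :: "'a bop"
    by (metis app_inject one_bop.rep_eq)
  ultimately show ?thesis by (simp add: unitaries_def)
qed

lemma convex_hull_unitary_orbit_conjugate:
  assumes "Y \<in> convex hull {V * B * star V | V. V \<in> G}"
    and "\<And>V. V \<in> G \<Longrightarrow> W * V \<in> G"
  shows "W * Y * star W \<in> convex hull {V * B * star V | V. V \<in> G}"
proof -
  have lin: "linear (\<lambda>Y. W * Y * star W)"
    by (rule linearI) (auto simp: algebra_simps)
  have "(\<lambda>Y. W * Y * star W) ` {V * B * star V | V. V \<in> G} \<subseteq> {V * B * star V | V. V \<in> G}"
  proof safe
    fix V assume "V \<in> G"
    then show "\<exists>V'. W * (V * B * star V) * star W = V' * B * star V' \<and> V' \<in> G"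
      using assms(2) by (intro exI[of _ "W * V"]) (simp add: star_mult mult.assoc)
  qed
  then have "(\<lambda>Y. W * Y * star W) ` (convex hull {V * B * star V | V. V \<in> G})
      \<subseteq> convex hull {V * B * star V | V. V \<in> G}"
    unfolding convex_hull_linear_image[OF lin] by (rule hull_mono)
  then show ?thesis using assms(1) by blast
qed

text \<open>
  Convex combinations are among the combinations with complex coefficients of total modulus at most one.
\<close>

lemma app_convex_hull_unitary_orbit:
  "app ` (convex hull {V * B * star V | V. app V \<in> unitaries M}) \<subseteq>
     {\<lambda>x. \<Sum>i<n. z i *\<^sub>C (V i \<circ> app B \<circ> adj (V i)) x
       | (n::nat) V z. (\<forall>i<n. V i \<in> unitaries M) \<and> (\<Sum>i<n. cmod (z i)) \<le> 1}"
proof safe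
  fix Y assume "Y \<in> convex hull {V * B * star V | V. app V \<in> unitaries M}"
  then obtain k u X where X: "\<forall>i\<in>{1::nat..k}. 0 \<le> u i \<and> X i \<in> {V * B * star V | V. app V \<in> unitaries M}"
    and u: "sum u {1..k} = 1" "(\<Sum>i=1..k. u i *\<^sub>R X i) = Y"
    unfolding convex_hull_indexed by blast
  have "\<forall>i\<in>{1..k}. \<exists>V. X i = V * B * star V \<and> app V \<in> unitaries M"
    using X by blast
  then obtain V where V: "\<And>i. i \<in> {1..k} \<Longrightarrow> X i = V i * B * star (V i) \<and> app (V i) \<in> unitaries M"
    by metis
  have "(\<Sum>i<k. cmod (complex_of_real (u (Suc i)))) = (\<Sum>i<k. u (Suc i))"
    by (rule sum.cong) (use X in auto)
  then have norm_sum: "(\<Sum>i<k. cmod (complex_of_real (u (Suc i)))) = 1"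
    using u(1) by (simp add: sum.atLeast1_atMost_eq)
  have "app Y = (\<lambda>x. \<Sum>i<k. complex_of_real (u (Suc i)) *\<^sub>C
      (app (V (Suc i)) \<circ> app B \<circ> adj (app (V (Suc i)))) x)"
  proof
    fix x
    have "app Y x = (\<Sum>i<k. app (u (Suc i) *\<^sub>R X (Suc i)) x)"
      unfolding u(2)[symmetric] app_sum by (simp add: sum.atLeast1_atMost_eq)
    also have "\<dots> = (\<Sum>i<k. complex_of_real (u (Suc i)) *\<^sub>C
      (app (V (Suc i)) \<circ> app B \<circ> adj (app (V (Suc i)))) x)"
      by (rule sum.cong) (use V in \<open>auto simp: scaleC_of_real simp flip: app_star\<close>)
    finally show "app Y x = \<dots>" .
  qed
  moreover have "\<forall>i<k. app (V (Suc i)) \<in> unitaries M"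
    using V by auto
  ultimately show "\<exists>(n::nat) V z. app Y = (\<lambda>x. \<Sum>i<n. z i *\<^sub>C (V i \<circ> app B \<circ> adj (V i)) x) \<and>
      (\<forall>i<n. V i \<in> unitaries M) \<and> (\<Sum>i<n. cmod (z i)) \<le> 1"
    using norm_sum
    by (intro exI[of _ k] exI[of _ "\<lambda>i. app (V (Suc i))"]
        exI[of _ "\<lambda>i. complex_of_real (u (Suc i))"]) simp
qed

theorem proposition1p4:
  fixes M :: "('h::complex_hilbert_space \<Rightarrow> 'h) set"
    and \<tau> :: "('h \<Rightarrow> 'h) \<Rightarrow> complex"
    and T U :: "'h \<Rightarrow> 'h"
    and f :: "complex poly"
    and l :: real
  assumes "finite_factor M"
    and "separable_predual M"
    and "faithful_normal_tracial_state M \<tau>"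
    and "T \<in> M"
    and "invertible_op T"
    and "polar_decomposition T U"
    and "0 \<le> l" and "l \<le> 1"
  shows "op_poly f (op_powr (op_abs T) l \<circ> U \<circ> op_powr (op_abs T) (1 - l))
         \<in> weak_op_topology closure_of
             {\<lambda>x. \<Sum>i<n. z i *\<^sub>C (V i \<circ> op_poly f T \<circ> adj (V i)) x
               | (n::nat) V z. (\<forall>i<n. V i \<in> unitaries M) \<and> (\<Sum>i<n. cmod (z i)) \<le> 1}"
proof -
  have vN: "von_neumann_algebra M"
    using assms(1) by (simp add: finite_factor_def factor_def)
  \<comment> \<open>The algebra as a set of operators of type \<^typ>\<open>'h bop\<close>: a norm closed unital *-subalgebra.\<close>
  define N where "N = {A :: 'h bop. app A \<in> M}"
  have add: "A + B \<in> N" and mult: "A * B \<in> N" if "A \<in> N" "B \<in> N" for A B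
  proof -
    have "app (A + B) = (\<lambda>x. app A x + app B x)" "app (A * B) = app A \<circ> app B" by auto
    then show "A + B \<in> N" "A * B \<in> N"
      using vN that unfolding von_neumann_algebra_def N_def by simp_all
  qed
  have star: "star A \<in> N" if "A \<in> N" for A
    using vN that unfolding von_neumann_algebra_def N_def by (simp add: app_star)
  have one: "1 \<in> N"
    using vN unfolding von_neumann_algebra_def N_def by (simp add: one_bop.rep_eq)
  have scalar: "scalar c \<in> N" for c
  proof -
    have "app (scalar c) = (\<lambda>x::'h. c *\<^sub>C id x)" by auto
    moreover have "(\<lambda>x. c *\<^sub>C id x) \<in> M"
      using vN unfolding von_neumann_algebra_def by blast
    ultimately show ?thesis by (simp add: N_def)
  qed
  have "closed N"
    using vN unfolding von_neumann_algebra_def N_def by (simp add: closed_app_vimage)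
  have poly: "bpoly p A \<in> N" if "A \<in> N" for p A
    by (induction p) (use scalar[of 0] in \<open>auto intro: add mult scalar that\<close>)
  have cpow: "cpow A w \<in> N" if "strictly_positive A" "A \<in> N" for A w
    using cpow_in_closed[OF that(1) \<open>closed N\<close> poly] that(2) .

  define S where "S = Bop T"
  have S: "app S = T"
    using assms(5) by (simp add: S_def invertible_op_def app_Bop)
  then have "S \<in> N" using assms(4) by (simp add: N_def)
  have "bop_unit S"
    using assms(5) S by (simp add: bop_unit_iff)
  then obtain S' where S': "S * S' = 1" "S' * S = 1"
    by (auto simp: bop_unit_def)
  define H where "H = cpow (star S * S) (complex_of_real (1 / 2))"
  have pos: "strictly_positive (star S * S)"
    using \<open>bop_unit S\<close> by (rule strictly_positive_star_mult)
  have H: "strictly_positive H" "H \<in> N" "star H = H"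
    using strictly_positive_cpow[OF pos, of "1 / 2"] cpow[OF pos] \<open>S \<in> N\<close>
    by (auto simp: H_def star mult strictly_positive_selfadjoint)
  have abs: "op_abs T = app H"
  proof -
    have "adj T \<circ> T = app (star S * S)" by (auto simp: app_star S)
    then show ?thesis
      using op_powr_eq_cpow[OF pos] by (simp add: op_abs_def H_def)
  qed
  have HH: "H * H = star S * S"
    using cpow_add[OF pos, of "1 / 2" "1 / 2"] by (simp add: H_def pos)
  define H' where "H' = cpow H (- 1)"
  have H': "H * H' = 1" "H' * H = 1" "star H' = H'" "H' \<in> N"
    using cpow_inverse[OF H(1), of 1] star_cpow[OF H(1), of "- 1"] cpow[OF H(1,2)]
    by (simp_all add: H'_def H(1))
  \<comment> \<open>Invertibility of \<open>T\<close> forces \<open>U = T |T|\<^sup>-\<^sup>1\<close>, which lies in the algebra and is unitary because \<open>|T|\<^sup>2 = T* T\<close>.\<close>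
  define W where "W = S * H'"
  have W: "app W = U"
  proof
    fix x
    have "app W x = T (app H' x)" by (simp add: W_def S)
    also have "\<dots> = U (app H (app H' x))"
      using assms(6) by (metis abs comp_apply polar_decomposition_def)
    also have "app H (app H' x) = x" using H'(1) by (metis app_mult app_one)
    finally show "app W x = U x" .
  qed
  have "star W * W = H' * (star S * S) * H'"
    by (simp add: W_def star_mult H' mult.assoc)
  also have "\<dots> = 1"
    by (simp flip: HH) (metis H'(1,2) mult.assoc mult_1_left)
  finally have W1: "star W * W = 1" .
  have W_inv: "W * (H * S') = 1"
    using S' H' by (metis W_def mult.assoc mult_1_left)
  then have starW: "star W = H * S'"
    using W1 by (metis mult.assoc mult_1_left mult_1_right)
  have W2: "W * star W = 1"
    using W_inv starW by simp
  have "W \<in> N" using \<open>S \<in> N\<close> H'(4) by (simp add: W_def mult)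

  define B where "B = bpoly f S"
  define G where "G = {V. app V \<in> unitaries M}"
  have G_iff: "V \<in> G \<longleftrightarrow> V \<in> N \<and> star V * V = 1 \<and> V * star V = 1" for V
    by (simp add: G_def N_def app_unitaries_iff)
  have G_mult: "V * V' \<in> G" if "V \<in> G" "V' \<in> G" for V V'
    using that mult by (auto simp: G_iff star_mult) (metis mult.assoc mult_1_left)+
  have it: "cpow H (\<i> * complex_of_real t) \<in> G" for t
    using cpow[OF H(1,2)] cpow_inverse[OF H(1), of "\<i> * complex_of_real t"]
    by (simp add: G_iff star_cpow[OF H(1)])
  define C where "C = convex hull {V * B * star V | V. V \<in> G}"
  have orbit: "V * B * star V \<in> C" if "V \<in> G" for V
    unfolding C_def by (rule hull_inc) (use that in blast)
  have "cpow H (complex_of_real l) * B * cpow H (- complex_of_real l) \<in> closure C"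
  proof (rule conjugate_cpow_in_closed_convex_hull[OF H(1)])
    show "convex C" by (simp add: C_def)
    show "B \<in> C" using orbit[of 1] one by (simp add: G_iff)
    \<comment> \<open>\<open>|T| = U* T\<close> and \<open>f(T)\<close> commutes with \<open>T\<close>, so conjugating by \<open>|T|\<close> is conjugating by \<open>U*\<close>.\<close>
    have "H * B * cpow H (- 1) = star W * B * star (star W)"
    proof -
      have "H * B * H' = H * (S' * S) * B * H'" by (simp add: S')
      also have "\<dots> = star W * (S * B) * H'" by (simp add: starW mult.assoc)
      also have "S * B = B * S" by (simp add: B_def bpoly_commute)
      finally show ?thesis by (simp add: W_def H'_def mult.assoc)
    qed
    then show "H * B * cpow H (- 1) \<in> C"
      using orbit[of "star W"] star[OF \<open>W \<in> N\<close>] W1 W2 by (simp add: G_iff)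
    show "cpow H (\<i> * complex_of_real t) * Y * cpow H (- (\<i> * complex_of_real t)) \<in> C"
      if "Y \<in> C" for Y t
      using convex_hull_unitary_orbit_conjugate[OF that[unfolded C_def], of "cpow H (\<i> * complex_of_real t)"]
        G_mult[OF it] by (simp add: C_def star_cpow[OF H(1)])
  qed (use assms in auto)
  moreover have "op_poly f (op_powr (op_abs T) l \<circ> U \<circ> op_powr (op_abs T) (1 - l))
      = app (cpow H (complex_of_real l) * B * cpow H (- complex_of_real l))"
  proof -
    \<comment> \<open>\<open>|T|\<^sup>l U |T|\<^sup>1\<^sup>-\<^sup>l = |T|\<^sup>l T |T|\<^sup>-\<^sup>l\<close>, and polynomials commute with similarities.\<close>
    have "cpow H (complex_of_real (1 - l)) = H * cpow H (- complex_of_real l)"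
      using cpow_add[OF H(1), of 1 "- complex_of_real l"] by (simp add: H(1))
    moreover have "W * H = S"
      by (simp add: W_def mult.assoc H')
    ultimately have "cpow H (complex_of_real l) * W * cpow H (complex_of_real (1 - l))
        = cpow H (complex_of_real l) * S * cpow H (- complex_of_real l)"
      by (metis mult.assoc)
    moreover have "op_powr (op_abs T) l \<circ> U \<circ> op_powr (op_abs T) (1 - l)
        = app (cpow H (complex_of_real l) * W * cpow H (complex_of_real (1 - l)))"
      by (auto simp: abs op_powr_eq_cpow[OF H(1)] W)
    ultimately show ?thesis
      by (simp add: B_def bpoly_similar[OF cpow_inverse[OF H(1)]] flip: app_bpoly)
  qed
  moreover have "app ` closure C \<subseteq> weak_op_topology closure_of
             {\<lambda>x. \<Sum>i<n. z i *\<^sub>C (V i \<circ> op_poly f T \<circ> adj (V i)) x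
               | (n::nat) V z. (\<forall>i<n. V i \<in> unitaries M) \<and> (\<Sum>i<n. cmod (z i)) \<le> 1}"
    using app_convex_hull_unitary_orbit[of B M] app_closure_subset[of C] closure_of_mono
    unfolding C_def G_def B_def app_bpoly S mem_Collect_eq by (meson order_trans)
  ultimately show ?thesis by auto
qed

end
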